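(* Let a two-level system $A$ and a single bosonic mode $B$ evolve unitarily (with $\hbar=1$) under the Jaynes–Cummings Hamiltonian $$H_{AB}=\omega_A\sigma_+\sigma_-+g(\sigma_+a+\sigma_-a^\dagger)+\omega_Ba^\dagger a ,$$ from an uncorrelated initial state $\rho_{AB}(0)=\rho_A(0)\otimes\rho_B(0)$, where $\rho_A(0)$ is arbitrary and $\rho_B(0)=e^{-\beta_BH_B}/\mathrm{Tr}[e^{-\beta_BH_B}]$ is the thermal state at inverse temperature $\beta_B$ of $H_B=\omega_Ba^\dagger a$. Let $\rho_A(t)=\mathrm{Tr}_B\rho_{AB}(t)$, $\rho_B(t)=\mathrm{Tr}_A\rho_{AB}(t)$, and define $$\sigma^{Es}(t)=\dot S_A(t)+\beta_B\dot E_B(t),\qquad \sigma^{fp}(t)=-\mathrm{Tr}\{\dot\rho_A(t)[\ln\rho_A(t)-\ln\rho_A^{fp}(t)]\},$$ where $S_A(t)=-\mathrm{Tr}[\rho_A(t)\ln\rho_A(t)]$, $\dot E_B(t)=\mathrm{Tr}[\dot\rho_B(t)H_B]$, and $\rho_A^{fp}(t)$ is the instantaneous fixed point of the exact reduced dynamics of $A$. Then $\sigma^{Es}(t)=\sigma^{fp}(t)$ for all times $t$ at which these quantities are defined.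
   Context: Here $\omega_A,\omega_B,\beta_B>0$, $g$ is real, $\sigma_+=|1\rangle\langle0|$, $\sigma_-=|0\rangle\langle1|$, $\sigma_z=|1\rangle\langle1|-|0\rangle\langle0|$ ($|1\rangle$ excited, $|0\rangle$ ground), and $a,a^\dagger$ are the annihilation and creation operators of $B$. The reduced dynamics of $A$ obeys an exact master equation $\dot\rho_A=\mathcal L_t\rho_A$ with $$\mathcal L_t\rho=-i[\Omega_A(t)\sigma_+\sigma_-,\rho]+\gamma_1(t)\big[\sigma_+\rho\sigma_--\tfrac12\{\sigma_-\sigma_+,\rho\}\big]+\gamma_2(t)\big[\sigma_-\rho\sigma_+-\tfrac12\{\sigma_+\sigma_-,\rho\}\big]+\tfrac12\gamma_3(t)[\sigma_z\rho\sigma_z-\rho],$$ where $\Omega_A,\gamma_3$ are real functions (entering only the evolution of the off-diagonal elements of $\rho_A$) and $$\gamma_1=\frac{\alpha\dot\beta-\dot\alpha\beta-\dot\beta}{\alpha+\beta-1},\qquad \gamma_2=\frac{\dot\alpha\beta-\alpha\dot\beta-\dot\alpha}{\alpha+\beta-1},$$ $$\alpha(t)=\sum_{n\ge0}\frac{e^{-n\beta_B\omega_B}}{Z}c_n(t),\quad \beta(t)=\sum_{n\ge0}\frac{e^{-n\beta_B\omega_B}}{Z}c_{n+1}(t),\quad c_n(t)=\cos^2\frac{\Omega_nt}{2}+\frac{\Delta^2}{\Omega_n^2}\sin^2\frac{\Omega_nt}{2},$$ with $\Delta=\omega_A-\omega_B$, $\Omega_n=\sqrt{\Delta^2+4g^2n}$,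 $Z=1/(1-e^{-\omega_B\beta_B})$ (and $c_0=1$). The instantaneous fixed point, satisfying $\mathcal L_t\rho_A^{fp}(t)=0$, is $$\rho_A^{fp}(t)=\frac{\gamma_1(t)}{\gamma_1(t)+\gamma_2(t)}|1\rangle\langle1|+\frac{\gamma_2(t)}{\gamma_1(t)+\gamma_2(t)}|0\rangle\langle0| .$$ The quantities are defined at times $t$ where the master equation coefficients exist (in particular $\alpha(t)+\beta(t)\ne1$), $\gamma_1(t)+\gamma_2(t)\neq0$, and $\rho_A(t)$ is invertible. *)

theory Defs
  imports "HOL-Analysis.Analysis"
begin

section \<open>Operators as matrices in an orthonormal basis\<close>

text \<open>
  An operator on the Hilbert space with orthonormal basis indexed by \<open>'i\<close> is represented by its
  (possibly infinite) matrix \<open>A i j = \<langle>i|A|j\<rangle>\<close>.  The mode \<open>B\<close> uses the Fock basis indexed by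
  \<^typ>\<open>nat\<close>, and the composite system \<open>AB\<close> the product basis indexed by \<^typ>\<open>2 \<times> nat\<close>.
\<close>

type_synonym 'i op = "'i \<Rightarrow> 'i \<Rightarrow> complex"

definition op_one :: "'i op" where
  "op_one = (\<lambda>i j. of_bool (i = j))"

definition op_mult :: "'i op \<Rightarrow> 'i op \<Rightarrow> 'i op" (infixl "\<odot>" 70) where
  "A \<odot> B = (\<lambda>i j. \<Sum>\<^sub>\<infinity>k. A i k * B k j)"

definition op_scale :: "complex \<Rightarrow> 'i op \<Rightarrow> 'i op" where
  "op_scale c A = (\<lambda>i j. c * A i j)"

definition op_add :: "'i op \<Rightarrow> 'i op \<Rightarrow> 'i op" (infixl "\<oplus>" 65) where
  "A \<oplus> B = (\<lambda>i j. A i j + B i j)"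

definition op_adj :: "'i op \<Rightarrow> 'i op" where
  "op_adj A = (\<lambda>i j. cnj (A j i))"

definition op_trace :: "'i op \<Rightarrow> complex" where
  "op_trace A = (\<Sum>\<^sub>\<infinity>i. A i i)"

primrec op_pow :: "'i op \<Rightarrow> nat \<Rightarrow> 'i op" where
  "op_pow A 0 = op_one"
| "op_pow A (Suc k) = A \<odot> op_pow A k"

text \<open>
  The exponential is the power series, taken matrix element by matrix element.  It is used below
  only for \<open>H\<^sub>A\<^sub>B\<close> and \<open>H\<^sub>B\<close>, which are unbounded but leave finite-dimensional subspaces spanned by
  basis vectors invariant; hence the basis vectors are analytic vectors, the series converges
  absolutely, and its sum is the matrix of the exponential of the self-adjoint operator.
\<close>

definition op_exp :: "'i op \<Rightarrow> 'i op" where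
  "op_exp A = (\<lambda>i j. \<Sum>k. op_pow A k i j / fact k)"

definition op_deriv :: "(real \<Rightarrow> 'i op) \<Rightarrow> real \<Rightarrow> 'i op" where
  "op_deriv A t = (\<lambda>i j. vector_derivative (\<lambda>s. A s i j) (at t))"

section \<open>The two-level system\<close>

text \<open>
  Operators on \<open>A\<close> are \<open>2 \<times> 2\<close> matrices; the index \<open>1 :: 2\<close> stands for the excited state \<open>|1\<rangle>\<close> and
  the index \<open>0 :: 2\<close> for the ground state \<open>|0\<rangle>\<close>.
\<close>

definition cscale :: "complex \<Rightarrow> complex^2^2 \<Rightarrow> complex^2^2" where
  "cscale c A = (\<chi> i j. c * A $ i $ j)"

definition cadj :: "complex^2^2 \<Rightarrow> complex^2^2" where
  "cadj A = (\<chi> i j. cnj (A $ j $ i))"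

definition ketbra :: "2 \<Rightarrow> 2 \<Rightarrow> complex^2^2" where
  "ketbra k l = (\<chi> i j. of_bool (i = k \<and> j = l))"

definition sigma_plus :: "complex^2^2" where "sigma_plus = ketbra 1 0"
definition sigma_minus :: "complex^2^2" where "sigma_minus = ketbra 0 1"
definition sigma_z :: "complex^2^2" where "sigma_z = ketbra 1 1 - ketbra 0 0"

definition density_matrix :: "complex^2^2 \<Rightarrow> bool" where
  "density_matrix \<rho> \<longleftrightarrow> cadj \<rho> = \<rho> \<and>
     (\<forall>v :: complex^2. 0 \<le> Re (\<Sum>i\<in>UNIV. cnj (v $ i) * (\<rho> *v v) $ i)) \<and>
     trace \<rho> = 1"

definition cunitary :: "complex^2^2 \<Rightarrow> bool" where
  "cunitary V \<longleftrightarrow> cadj V ** V = mat 1 \<and> V ** cadj V = mat 1"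

definition rdiag :: "(2 \<Rightarrow> real) \<Rightarrow> complex^2^2" where
  "rdiag d = (\<chi> i j. if i = j then complex_of_real (d i) else 0)"

text \<open>
  Logarithm of a positive Hermitian matrix by functional calculus.  With \<^prop>\<open>ln 0 = (0::real)\<close> the
  product \<open>\<rho> ln \<rho>\<close> follows the usual convention \<open>0 ln 0 = 0\<close>.
\<close>

definition herm_fun :: "(real \<Rightarrow> real) \<Rightarrow> complex^2^2 \<Rightarrow> complex^2^2" where
  "herm_fun f A = (THE B. \<exists>V d. cunitary V \<and> A = V ** rdiag d ** cadj V \<and>
                                B = V ** rdiag (\<lambda>i. f (d i)) ** cadj V)"

definition mat_ln :: "complex^2^2 \<Rightarrow> complex^2^2" where
  "mat_ln = herm_fun ln"

section \<open>Jaynes--Cummings dynamics\<close>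

definition tens :: "complex^2^2 \<Rightarrow> nat op \<Rightarrow> (2 \<times> nat) op" (infixl "\<otimes>" 75) where
  "X \<otimes> Y = (\<lambda>(i, m) (j, n). X $ i $ j * Y m n)"

definition ann :: "nat op" where
  "ann = (\<lambda>m n. if n = Suc m then complex_of_real (sqrt (real n)) else 0)"

definition H_B :: "real \<Rightarrow> nat op" where
  "H_B \<omega>B = op_scale \<omega>B (op_adj ann \<odot> ann)"

definition H_AB :: "real \<Rightarrow> real \<Rightarrow> real \<Rightarrow> (2 \<times> nat) op" where
  "H_AB \<omega>A \<omega>B g =
     op_scale \<omega>A ((sigma_plus ** sigma_minus) \<otimes> op_one)
     \<oplus> op_scale g (sigma_plus \<otimes> ann \<oplus> sigma_minus \<otimes> op_adj ann)
     \<oplus> mat 1 \<otimes> H_B \<omega>B"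

definition thermal :: "real \<Rightarrow> real \<Rightarrow> nat op" where
  "thermal \<omega>B \<beta>B =
     (let G = op_exp (op_scale (- \<beta>B) (H_B \<omega>B)) in op_scale (1 / op_trace G) G)"

definition U_AB :: "real \<Rightarrow> real \<Rightarrow> real \<Rightarrow> real \<Rightarrow> (2 \<times> nat) op" where
  "U_AB \<omega>A \<omega>B g t = op_exp (op_scale (- \<i> * complex_of_real t) (H_AB \<omega>A \<omega>B g))"

definition rho_AB ::
  "real \<Rightarrow> real \<Rightarrow> real \<Rightarrow> real \<Rightarrow> complex^2^2 \<Rightarrow> real \<Rightarrow> (2 \<times> nat) op" where
  "rho_AB \<omega>A \<omega>B \<beta>B g \<rho>0 t =
     U_AB \<omega>A \<omega>B g t \<odot> (\<rho>0 \<otimes> thermal \<omega>B \<beta>B) \<odot> op_adj (U_AB \<omega>A \<omega>B g t)"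

definition rho_A ::
  "real \<Rightarrow> real \<Rightarrow> real \<Rightarrow> real \<Rightarrow> complex^2^2 \<Rightarrow> real \<Rightarrow> complex^2^2" where
  "rho_A \<omega>A \<omega>B \<beta>B g \<rho>0 t =
     (\<chi> i j. \<Sum>\<^sub>\<infinity>n. rho_AB \<omega>A \<omega>B \<beta>B g \<rho>0 t (i, n) (j, n))"

definition rho_B ::
  "real \<Rightarrow> real \<Rightarrow> real \<Rightarrow> real \<Rightarrow> complex^2^2 \<Rightarrow> real \<Rightarrow> nat op" where
  "rho_B \<omega>A \<omega>B \<beta>B g \<rho>0 t =
     (\<lambda>m n. \<Sum>i\<in>UNIV. rho_AB \<omega>A \<omega>B \<beta>B g \<rho>0 t (i, m) (i, n))"

section \<open>Exact master equation and its instantaneous fixed point\<close>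

text \<open>
  For \<open>n = 0\<close> the formula gives \<open>c\<^sub>0 = 1\<close>, also on resonance, where \<^prop>\<open>x / 0 = (0::real)\<close> only
  meets the factor \<open>sin 0\<close>.
\<close>

definition rabi :: "real \<Rightarrow> real \<Rightarrow> real \<Rightarrow> nat \<Rightarrow> real" where
  "rabi \<omega>A \<omega>B g n = sqrt ((\<omega>A - \<omega>B)\<^sup>2 + 4 * g\<^sup>2 * real n)"

definition c_coeff :: "real \<Rightarrow> real \<Rightarrow> real \<Rightarrow> nat \<Rightarrow> real \<Rightarrow> real" where
  "c_coeff \<omega>A \<omega>B g n t =
     (cos (rabi \<omega>A \<omega>B g n * t / 2))\<^sup>2
     + (\<omega>A - \<omega>B)\<^sup>2 / (rabi \<omega>A \<omega>B g n)\<^sup>2 * (sin (rabi \<omega>A \<omega>B g n * t / 2))\<^sup>2"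

definition Z_B :: "real \<Rightarrow> real \<Rightarrow> real" where
  "Z_B \<omega>B \<beta>B = 1 / (1 - exp (- \<omega>B * \<beta>B))"

definition alpha :: "real \<Rightarrow> real \<Rightarrow> real \<Rightarrow> real \<Rightarrow> real \<Rightarrow> real" where
  "alpha \<omega>A \<omega>B \<beta>B g t =
     (\<Sum>n. exp (- real n * \<beta>B * \<omega>B) / Z_B \<omega>B \<beta>B * c_coeff \<omega>A \<omega>B g n t)"

definition beta :: "real \<Rightarrow> real \<Rightarrow> real \<Rightarrow> real \<Rightarrow> real \<Rightarrow> real" where
  "beta \<omega>A \<omega>B \<beta>B g t =
     (\<Sum>n. exp (- real n * \<beta>B * \<omega>B) / Z_B \<omega>B \<beta>B * c_coeff \<omega>A \<omega>B g (n + 1) t)"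

definition gamma1 :: "real \<Rightarrow> real \<Rightarrow> real \<Rightarrow> real \<Rightarrow> real \<Rightarrow> real" where
  "gamma1 \<omega>A \<omega>B \<beta>B g t =
     (let \<alpha> = alpha \<omega>A \<omega>B \<beta>B g; \<beta> = beta \<omega>A \<omega>B \<beta>B g
      in (\<alpha> t * deriv \<beta> t - deriv \<alpha> t * \<beta> t - deriv \<beta> t) / (\<alpha> t + \<beta> t - 1))"

definition gamma2 :: "real \<Rightarrow> real \<Rightarrow> real \<Rightarrow> real \<Rightarrow> real \<Rightarrow> real" where
  "gamma2 \<omega>A \<omega>B \<beta>B g t =
     (let \<alpha> = alpha \<omega>A \<omega>B \<beta>B g; \<beta> = beta \<omega>A \<omega>B \<beta>B g
      in (deriv \<alpha> t * \<beta> t - \<alpha> t * deriv \<beta> t - deriv \<alpha> t) / (\<alpha> t + \<beta> t - 1))"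

text \<open>
  The generator of the master equation, with its coefficients at a fixed time as arguments.
\<close>

definition generator ::
  "real \<Rightarrow> real \<Rightarrow> real \<Rightarrow> real \<Rightarrow> complex^2^2 \<Rightarrow> complex^2^2" where
  "generator \<Omega>A \<gamma>1 \<gamma>2 \<gamma>3 \<rho> =
     (let p = sigma_plus; m = sigma_minus; z = sigma_z in
      cscale (- \<i> * \<Omega>A) (p ** m ** \<rho> - \<rho> ** (p ** m))
      + cscale \<gamma>1 (p ** \<rho> ** m - cscale (1/2) (m ** p ** \<rho> + \<rho> ** (m ** p)))
      + cscale \<gamma>2 (m ** \<rho> ** p - cscale (1/2) (p ** m ** \<rho> + \<rho> ** (p ** m)))
      + cscale (\<gamma>3 / 2) (z ** \<rho> ** z - \<rho>))"

definition rho_fp :: "real \<Rightarrow> real \<Rightarrow> real \<Rightarrow> real \<Rightarrow> real \<Rightarrow> complex^2^2" where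
  "rho_fp \<omega>A \<omega>B \<beta>B g t =
     (let \<gamma>1 = gamma1 \<omega>A \<omega>B \<beta>B g t; \<gamma>2 = gamma2 \<omega>A \<omega>B \<beta>B g t
      in cscale (\<gamma>1 / (\<gamma>1 + \<gamma>2)) (ketbra 1 1) + cscale (\<gamma>2 / (\<gamma>1 + \<gamma>2)) (ketbra 0 0))"

text \<open>
  Whatever \<open>\<Omega>\<^sub>A\<close> and \<open>\<gamma>\<^sub>3\<close> are, \<^const>\<open>rho_fp\<close> is a fixed point of the generator; it is the only one
  of trace one unless the generator annihilates all off-diagonal matrices.
\<close>

lemma all_2: "(\<forall>i::2. P i) \<longleftrightarrow> P 0 \<and> P 1"
proof -
  have "i = 0 \<or> i = 1" for i :: 2
    using exhaust_2 [of i] by auto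
  then show ?thesis by metis
qed

lemma sum_2_01: "sum f (UNIV :: 2 set) = f 0 + f 1"
proof -
  have "(2::2) = 0" by simp
  then show ?thesis using sum_2 [of f] by (metis add.commute)
qed

lemma mult_2_01:
  fixes A B :: "complex^2^2"
  shows "(A ** B) $ i $ j = A $ i $ 0 * B $ 0 $ j + A $ i $ 1 * B $ 1 $ j"
  by (simp add: matrix_matrix_mult_def sum_2_01)

lemma generator_entries:
  fixes X :: "complex^2^2"
  shows "generator \<Omega>A \<gamma>1 \<gamma>2 \<gamma>3 X $ 1 $ 1 = \<gamma>1 * X $ 0 $ 0 - \<gamma>2 * X $ 1 $ 1"
    and "generator \<Omega>A \<gamma>1 \<gamma>2 \<gamma>3 X $ 0 $ 0 = \<gamma>2 * X $ 1 $ 1 - \<gamma>1 * X $ 0 $ 0"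
    and "generator \<Omega>A \<gamma>1 \<gamma>2 \<gamma>3 X $ 1 $ 0 = (- \<i> * \<Omega>A - ((\<gamma>1 + \<gamma>2) / 2 + \<gamma>3)) * X $ 1 $ 0"
    and "generator \<Omega>A \<gamma>1 \<gamma>2 \<gamma>3 X $ 0 $ 1 = (\<i> * \<Omega>A - ((\<gamma>1 + \<gamma>2) / 2 + \<gamma>3)) * X $ 0 $ 1"
  by (simp_all add: generator_def Let_def cscale_def mult_2_01 sigma_plus_def sigma_minus_def
      sigma_z_def ketbra_def, simp_all add: algebra_simps)

lemma rho_fp_entries:
  fixes \<omega>A \<omega>B \<beta>B g t :: real
  defines "a \<equiv> complex_of_real (gamma1 \<omega>A \<omega>B \<beta>B g t)"
    and "b \<equiv> complex_of_real (gamma2 \<omega>A \<omega>B \<beta>B g t)"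
  shows "rho_fp \<omega>A \<omega>B \<beta>B g t $ 1 $ 1 = a / (a + b)"
    and "rho_fp \<omega>A \<omega>B \<beta>B g t $ 0 $ 0 = b / (a + b)"
    and "rho_fp \<omega>A \<omega>B \<beta>B g t $ 1 $ 0 = 0"
    and "rho_fp \<omega>A \<omega>B \<beta>B g t $ 0 $ 1 = 0"
  by (simp_all add: a_def b_def rho_fp_def Let_def cscale_def ketbra_def)

lemma generator_rho_fp:
  "generator \<Omega>A (gamma1 \<omega>A \<omega>B \<beta>B g t) (gamma2 \<omega>A \<omega>B \<beta>B g t) \<gamma>3 (rho_fp \<omega>A \<omega>B \<beta>B g t) = 0"
  unfolding vec_eq_iff all_2 generator_entries rho_fp_entries by simp

lemma generator_fixed_point_unique:
  assumes "gamma1 \<omega>A \<omega>B \<beta>B g t + gamma2 \<omega>A \<omega>B \<beta>B g t \<noteq> 0"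
    and "\<Omega>A \<noteq> 0 \<or> (gamma1 \<omega>A \<omega>B \<beta>B g t + gamma2 \<omega>A \<omega>B \<beta>B g t) / 2 + \<gamma>3 \<noteq> 0"
    and "generator \<Omega>A (gamma1 \<omega>A \<omega>B \<beta>B g t) (gamma2 \<omega>A \<omega>B \<beta>B g t) \<gamma>3 X = 0"
    and "trace X = 1"
  shows "X = rho_fp \<omega>A \<omega>B \<beta>B g t"
proof -
  define a where "a = gamma1 \<omega>A \<omega>B \<beta>B g t"
  define b where "b = gamma2 \<omega>A \<omega>B \<beta>B g t"
  define r where "r = (a + b) / 2 + \<gamma>3"
  have G: "generator \<Omega>A a b \<gamma>3 X $ i $ j = 0" for i j
    using assms(3) by (simp add: a_def b_def)
  have r: "(complex_of_real a + b) / 2 + \<gamma>3 = r" by (simp add: r_def)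
  have diag: "complex_of_real a * X $ 0 $ 0 - b * X $ 1 $ 1 = 0"
    using G [of 1 1] unfolding generator_entries .
  have E: "(- \<i> * \<Omega>A - r) * X $ 1 $ 0 = 0" "(\<i> * \<Omega>A - r) * X $ 0 $ 1 = 0"
    using G [of 1 0] G [of 0 1] unfolding generator_entries r by - assumption+
  have "\<Omega>A \<noteq> 0 \<or> r \<noteq> 0" using assms(2) by (simp add: r_def a_def b_def)
  then have "- \<i> * \<Omega>A - r \<noteq> 0" "\<i> * \<Omega>A - r \<noteq> 0"
    by (auto simp: complex_eq_iff)
  then have off: "X $ 1 $ 0 = 0" "X $ 0 $ 1 = 0"
    using E mult_eq_0_iff by blast+
  have "complex_of_real (a + b) \<noteq> 0"
    using assms(1) unfolding a_def b_def of_real_eq_0_iff .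
  then have ab: "complex_of_real a + b \<noteq> 0" by simp
  have tr: "X $ 0 $ 0 + X $ 1 $ 1 = 1"
    using assms(4) by (simp add: trace_def sum_2_01)
  have "(complex_of_real a + b) * X $ 1 $ 1 = a * (X $ 0 $ 0 + X $ 1 $ 1)"
    using diag by (simp add: algebra_simps)
  then have X1: "X $ 1 $ 1 = a / (complex_of_real a + b)"
    unfolding tr by (metis ab mult.right_neutral nonzero_mult_div_cancel_left)
  have "(complex_of_real a + b) * X $ 0 $ 0 = b * (X $ 0 $ 0 + X $ 1 $ 1)"
    using diag by (simp add: algebra_simps)
  then have X0: "X $ 0 $ 0 = b / (complex_of_real a + b)"
    unfolding tr by (metis ab mult.right_neutral nonzero_mult_div_cancel_left)
  show ?thesis
    unfolding vec_eq_iff all_2 rho_fp_entries off X0 X1 a_def b_def by blast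
qed

section \<open>Entropy production rates\<close>

text \<open>
  All quantities are kept complex-valued (their values are real), so that no real part has to be
  taken.
\<close>

definition S_A ::
  "real \<Rightarrow> real \<Rightarrow> real \<Rightarrow> real \<Rightarrow> complex^2^2 \<Rightarrow> real \<Rightarrow> complex" where
  "S_A \<omega>A \<omega>B \<beta>B g \<rho>0 t =
     - trace (rho_A \<omega>A \<omega>B \<beta>B g \<rho>0 t ** mat_ln (rho_A \<omega>A \<omega>B \<beta>B g \<rho>0 t))"

definition dE_B ::
  "real \<Rightarrow> real \<Rightarrow> real \<Rightarrow> real \<Rightarrow> complex^2^2 \<Rightarrow> real \<Rightarrow> complex" where
  "dE_B \<omega>A \<omega>B \<beta>B g \<rho>0 t = op_trace (op_deriv (rho_B \<omega>A \<omega>B \<beta>B g \<rho>0) t \<odot> H_B \<omega>B)"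

definition sigma_Es ::
  "real \<Rightarrow> real \<Rightarrow> real \<Rightarrow> real \<Rightarrow> complex^2^2 \<Rightarrow> real \<Rightarrow> complex" where
  "sigma_Es \<omega>A \<omega>B \<beta>B g \<rho>0 t =
     vector_derivative (S_A \<omega>A \<omega>B \<beta>B g \<rho>0) (at t) + \<beta>B * dE_B \<omega>A \<omega>B \<beta>B g \<rho>0 t"

definition sigma_fp ::
  "real \<Rightarrow> real \<Rightarrow> real \<Rightarrow> real \<Rightarrow> complex^2^2 \<Rightarrow> real \<Rightarrow> complex" where
  "sigma_fp \<omega>A \<omega>B \<beta>B g \<rho>0 t =
     - trace (vector_derivative (rho_A \<omega>A \<omega>B \<beta>B g \<rho>0) (at t) **
         (mat_ln (rho_A \<omega>A \<omega>B \<beta>B g \<rho>0 t) - mat_ln (rho_fp \<omega>A \<omega>B \<beta>B g t)))"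

end

theory Submission
  imports Defs
begin

text \<open>
  The excitation number is conserved, so the energy gained by the mode is \<open>\<omega>\<^sub>B\<close> times the excited-state
  population lost by the two-level system, \<open>dE\<^sub>B = - \<omega>\<^sub>B d\<rho>\<^sub>A $ 1 $ 1\<close>.  On the other hand, with
  \<open>q = exp (- \<beta>\<^sub>B \<omega>\<^sub>B)\<close> the Boltzmann weights satisfy \<open>p\<^sub>n\<^sub>+\<^sub>1 = q p\<^sub>n\<close>, and \<open>c\<^sub>0 = 1\<close> then gives
  \<open>1 - \<alpha> = q (1 - \<beta>)\<close>, hence \<open>\<gamma>\<^sub>1 = q \<gamma>\<^sub>2\<close> and the instantaneous fixed point is always the Gibbs state
  at inverse temperature \<open>\<beta>\<^sub>B\<close>.  Therefore \<open>Tr (d\<rho>\<^sub>A ln \<rho>\<^sub>f\<^sub>p) = ln q d\<rho>\<^sub>A $ 1 $ 1 = \<beta>\<^sub>B dE\<^sub>B\<close>, and the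
  remaining terms agree because \<open>dS\<^sub>A = - Tr (d\<rho>\<^sub>A ln \<rho>\<^sub>A)\<close>.
\<close>

section \<open>Functional calculus for Hermitian two-by-two matrices\<close>

text \<open>Both rates are written with \<open>vector_derivative\<close>, which carries no
  information until differentiability is proved, so most of the work is analytic. Three obstacles
  shape it. First, \<open>mat_ln\<close> is a definite description over all diagonalisations, and
  eigenvalues of a differentiable matrix path need not be differentiable where they meet. On a
  spectrum of two points every function is affine; this makes the description well defined and
  reduces the entropy to a function of the length of the Bloch vector, which has a critical point
  exactly where the eigenvalues meet. Second, the propagator is the power series of an infinite
  matrix; its blocks of fixed excitation number have size at most two, so that all powers have a
  closed form. Third, partial traces are infinite sums. Differentiating a term costs a factor linear
  in the Fock number, the energy costs another, and the geometric thermal weights absorb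
  both.\<close>

lemma two_eq_zero: "(2::2) = 0" by simp

lemma mat2_eq_iff:
  fixes A B :: "complex^2^2"
  shows "A = B \<longleftrightarrow> A $ 0 $ 0 = B $ 0 $ 0 \<and> A $ 0 $ 1 = B $ 0 $ 1 \<and> A $ 1 $ 0 = B $ 1 $ 0 \<and> A $ 1 $ 1 = B $ 1 $ 1"
  by (simp add: vec_eq_iff all_2 conj_assoc)

lemma trace_2_01: "trace (A :: complex^2^2) = A $ 0 $ 0 + A $ 1 $ 1"
  by (simp add: trace_def sum_2_01)

lemma det_2_01: "det (A :: complex^2^2) = A $ 0 $ 0 * A $ 1 $ 1 - A $ 0 $ 1 * A $ 1 $ 0"
  using det_2 [of A] by (simp add: two_eq_zero mult.commute)

lemma cscale_mult:
  "cscale c A ** B = cscale c (A ** B)" "A ** cscale c B = cscale c (A ** B)"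
  by (simp_all add: mat2_eq_iff mult_2_01 cscale_def algebra_simps)

lemma add_matrix_mult: "(A + B) ** C = A ** C + B ** C" for A B C :: "complex^2^2"
  by (simp add: mat2_eq_iff mult_2_01 algebra_simps)

lemma rdiag_nth:
  "rdiag d $ 0 $ 0 = of_real (d 0)" "rdiag d $ 1 $ 1 = of_real (d 1)"
  "rdiag d $ 0 $ 1 = 0" "rdiag d $ 1 $ 0 = 0"
  by (simp_all add: rdiag_def)

lemma hermitian_entries:
  assumes "cadj A = A"
  shows "A $ 1 $ 0 = cnj (A $ 0 $ 1)" "of_real (Re (A $ 0 $ 0)) = A $ 0 $ 0"
    "of_real (Re (A $ 1 $ 1)) = A $ 1 $ 1"
proof -
  have h: "cnj (A $ j $ i) = A $ i $ j" for i j
    using arg_cong[OF assms, of "\<lambda>M. M $ i $ j"] by (simp add: cadj_def)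
  show "A $ 1 $ 0 = cnj (A $ 0 $ 1)" by (rule h[symmetric])
  show "of_real (Re (A $ 0 $ 0)) = A $ 0 $ 0" "of_real (Re (A $ 1 $ 1)) = A $ 1 $ 1"
    using h[of 0 0] h[of 1 1] by (simp_all add: complex_eq_iff)
qed

text \<open>Provides the witness that the definite description in \<open>herm_fun\<close>
  requires.\<close>

lemma hermitian_diagonalizable:
  assumes "cadj A = A"
  obtains V d where "cunitary V" "A = V ** rdiag d ** cadj V"
proof (cases "A $ 0 $ 1 = 0")
  case True
  have "A = mat 1 ** rdiag (\<lambda>i. Re (A $ i $ i)) ** cadj (mat 1)" "cunitary (mat 1)"
    using hermitian_entries[OF assms] True
    by (simp_all add: mat2_eq_iff mult_2_01 rdiag_nth cunitary_def cadj_def mat_def)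
  then show ?thesis using that by blast
next
  case False
  define a c b where "a = Re (A $ 0 $ 0)" and "c = Re (A $ 1 $ 1)" and "b = A $ 0 $ 1"
  \<comment> \<open>\<open>m\<close> is chosen as a root of m * (m + a - c) = |b|^2: then (b, m) is
    an eigenvector with eigenvalue a + m, and the orthogonal vector (- m, cnj b) has eigenvalue c -
    m.\<close>
  define k m where "k = sqrt ((a - c)\<^sup>2 + 4 * (cmod b)\<^sup>2)" and "m = (c - a + k) / 2"
  have "k\<^sup>2 = (a - c)\<^sup>2 + 4 * (cmod b)\<^sup>2" by (simp add: k_def)
  then have m: "m * (m + a - c) = (cmod b)\<^sup>2"
    by (simp add: m_def power2_eq_square field_simps)
  have bb: "b * cnj b = of_real ((cmod b)\<^sup>2)"
    using complex_norm_square[of b] by simp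
  have A: "A $ 0 $ 0 = of_real a" "A $ 1 $ 1 = of_real c" "A $ 0 $ 1 = b" "A $ 1 $ 0 = cnj b"
    using hermitian_entries[OF assms] by (simp_all add: a_def b_def c_def)
  define N where "N = sqrt ((cmod b)\<^sup>2 + m\<^sup>2)"
  have "(cmod b)\<^sup>2 + m\<^sup>2 > 0" using False by (simp add: b_def add_pos_nonneg)
  then have N: "N > 0" "N\<^sup>2 = (cmod b)\<^sup>2 + m\<^sup>2" by (simp_all add: N_def)
  then have N2: "complex_of_real N * of_real N = b * cnj b + of_real m * of_real m"
    unfolding bb by (simp add: power2_eq_square flip: of_real_mult of_real_add)
  define W :: "complex^2^2" where
    "W = (\<chi> i j. if i = 0 then (if j = 0 then b else - m) else (if j = 0 then m else cnj b))"
  define V where "V = cscale (1 / N) W"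
  define d where "d = (\<lambda>i::2. if i = 0 then a + m else c - m)"
  have W: "W $ 0 $ 0 = b" "W $ 0 $ 1 = - m" "W $ 1 $ 0 = m" "W $ 1 $ 1 = cnj b"
    by (simp_all add: W_def)
  have W': "cadj W $ 0 $ 0 = cnj b" "cadj W $ 1 $ 0 = - m" "cadj W $ 0 $ 1 = m" "cadj W $ 1 $ 1 = b"
    by (simp_all add: cadj_def W)
  have V': "cadj V = cscale (1 / N) (cadj W)"
    by (simp add: cadj_def V_def cscale_def)
  have WW: "W ** cadj W = cscale (N * N) (mat 1)" "cadj W ** W = cscale (N * N) (mat 1)"
    unfolding of_real_mult N2 mat2_eq_iff mult_2_01 W W' by (simp_all add: cscale_def mat_def)
  have unit: "cunitary V"
    unfolding cunitary_def V' unfolding V_def cscale_mult WW using N(1)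
    by (simp add: mat2_eq_iff cscale_def)
  have mm: "complex_of_real m * (m + a - c) = b * cnj b"
    unfolding bb m[symmetric] by simp
  have "A ** W = W ** rdiag d"
    unfolding mat2_eq_iff mult_2_01 W A rdiag_nth d_def
    using mm by (simp add: algebra_simps)
  then have "A ** V = V ** rdiag d" by (simp add: V_def cscale_mult)
  moreover have "A = A ** (V ** cadj V)" using unit by (simp add: cunitary_def)
  ultimately have "A = V ** rdiag d ** cadj V" by (simp add: matrix_mul_assoc)
  with unit show ?thesis by (rule that)
qed

text \<open>Vieta: both pairs are the roots of one monic quadratic.\<close>

lemma sum_prod_eq_cases:
  fixes a b c d :: real
  assumes "a + b = c + d" "a * b = c * d"
  shows "(a = c \<or> a = d) \<and> (b = c \<or> b = d)"
proof -
  have "(x - c) * (x - d) = x * x - (a + b) * x + a * b" for x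
    unfolding assms by (simp add: algebra_simps)
  from this[of a] this[of b] have "(a - c) * (a - d) = 0" "(b - c) * (b - d) = 0"
    by (simp_all add: algebra_simps)
  then show ?thesis by auto
qed

text \<open>On a spectrum of two points every function agrees with an affine one, so all
  diagonalisations of \<open>A\<close> produce the same matrix and \<open>THE\<close> is justified.
  The spectrum is prescribed through trace and determinant, so that no eigenvectors have to be
  supplied.\<close>

lemma herm_fun_affine:
  fixes l m x y :: real
  assumes A: "cadj A = A"
    and tr: "trace A = of_real (l + m)" and det: "det A = of_real (l * m)"
    and f: "f l = x + y * l" "f m = x + y * m"
  shows "herm_fun f A = cscale x (mat 1) + cscale y A"
proof -
  have *: "V ** rdiag (\<lambda>i. f (d i)) ** cadj V = cscale x (mat 1) + cscale y A"
    if V: "cunitary V" and AV: "A = V ** rdiag d ** cadj V" for V d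
  proof -
    have VV: "cadj V ** V = mat 1" "V ** cadj V = mat 1" using V by (auto simp: cunitary_def)
    have "trace A = trace (cadj V ** (V ** rdiag d))" unfolding AV by (rule trace_mul_sym)
    also have "\<dots> = trace (rdiag d)" by (simp add: matrix_mul_assoc VV)
    finally have s: "of_real (d 0 + d 1) = complex_of_real (l + m)"
      by (simp add: tr trace_2_01[of "rdiag d"] rdiag_nth)
    have "det A = (det (cadj V) * det V) * det (rdiag d)" unfolding AV by (simp add: det_mul)
    also have "\<dots> = det (rdiag d)" by (metis VV(1) det_I det_mul mult_1)
    finally have p: "of_real (d 0 * d 1) = complex_of_real (l * m)"
      by (simp add: det det_2_01[of "rdiag d"] rdiag_nth)
    have "(d 0 = l \<or> d 0 = m) \<and> (d 1 = l \<or> d 1 = m)"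
      using sum_prod_eq_cases s p unfolding of_real_eq_iff by blast
    then have "f (d 0) = x + y * d 0" "f (d 1) = x + y * d 1" using f by auto
    then have "rdiag (\<lambda>i. f (d i)) = cscale x (mat 1) + cscale y (rdiag d)"
      by (simp add: mat2_eq_iff rdiag_nth cscale_def mat_def)
    then show ?thesis
      by (simp add: AV cscale_mult matrix_add_ldistrib add_matrix_mult VV)
  qed
  obtain V d where V: "cunitary V" "A = V ** rdiag d ** cadj V"
    using hermitian_diagonalizable[OF A] .
  show ?thesis unfolding herm_fun_def
  proof (rule the_equality)
    show "\<exists>V d. cunitary V \<and> A = V ** rdiag d ** cadj V \<and>
      cscale x (mat 1) + cscale y A = V ** rdiag (\<lambda>i. f (d i)) ** cadj V"
      using V *[OF V] by metis
  qed (use * in blast)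
qed

text \<open>For \<open>l = m\<close> division by zero makes \<open>y\<close> zero, and the constant
  interpolant is then right. The value of \<open>y\<close> is recorded because this divided
  difference is the coefficient that the entropy derivative has to produce.\<close>

lemma affine_interpolation:
  fixes l m :: real
  shows "\<exists>x y. f l = x + y * l \<and> f m = x + y * m \<and> y = (f l - f m) / (l - m)"
proof (intro exI conjI)
  let ?y = "(f l - f m) / (l - m)"
  show "f l = (f l - ?y * l) + ?y * l" by simp
  have "?y * (l - m) = f l - f m" by (cases "l = m") simp_all
  then show "f m = (f l - ?y * l) + ?y * m" by (simp add: right_diff_distrib)
qed (rule refl)

text \<open>Only Tr A and Tr A^2 = (Tr A)^2 - 2 det A enter, both symmetric functions of the
  eigenvalues.\<close>

lemma trace_mult_herm_fun:
  fixes l m :: real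
  assumes A: "cadj A = A"
    and tr: "trace A = of_real (l + m)" and det: "det A = of_real (l * m)"
  shows "trace (A ** herm_fun f A) = of_real (l * f l + m * f m)"
proof -
  obtain x y where f: "f l = x + y * l" "f m = x + y * m"
    using affine_interpolation[of f l m] by blast
  have "trace (A ** A) = (trace A)\<^sup>2 - 2 * det A"
    by (simp add: trace_2_01 det_2_01 mult_2_01 power2_eq_square algebra_simps)
  also have "\<dots> = of_real (l\<^sup>2 + m\<^sup>2)"
    unfolding tr det by (simp add: power2_eq_square algebra_simps)
  finally have "trace (A ** A) = of_real (l\<^sup>2 + m\<^sup>2)" .
  moreover have "trace (A ** herm_fun f A) = of_real x * trace A + of_real y * trace (A ** A)"
    unfolding herm_fun_affine[where f=f, OF A tr det f]
    by (simp add: trace_2_01 mult_2_01 cscale_def mat_def algebra_simps)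
  ultimately have "trace (A ** herm_fun f A) = of_real (x * (l + m) + y * (l\<^sup>2 + m\<^sup>2))"
    by (simp only: tr of_real_mult of_real_add)
  also have "x * (l + m) + y * (l\<^sup>2 + m\<^sup>2) = l * f l + m * f m"
    unfolding f by (simp add: power2_eq_square algebra_simps)
  finally show ?thesis .
qed

lemma herm_fun_diagonal:
  fixes A :: "complex^2^2" and l m :: real
  assumes "A $ 0 $ 0 = of_real l" "A $ 1 $ 1 = of_real m" "A $ 0 $ 1 = 0" "A $ 1 $ 0 = 0"
  shows "herm_fun f A $ 0 $ 0 = of_real (f l)" "herm_fun f A $ 1 $ 1 = of_real (f m)"
    "herm_fun f A $ 0 $ 1 = 0" "herm_fun f A $ 1 $ 0 = 0"
proof -
  obtain x y where f: "f l = x + y * l" "f m = x + y * m"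
    using affine_interpolation[of f l m] by blast
  have "herm_fun f A = cscale x (mat 1) + cscale y A"
    by (rule herm_fun_affine[OF _ _ _ f])
      (use assms in \<open>simp_all add: mat2_eq_iff cadj_def trace_2_01 det_2_01\<close>)
  then show "herm_fun f A $ 0 $ 0 = of_real (f l)" "herm_fun f A $ 1 $ 1 = of_real (f m)"
    "herm_fun f A $ 0 $ 1 = 0" "herm_fun f A $ 1 $ 0 = 0"
    using f assms by (simp_all add: cscale_def mat_def)
qed

section \<open>Derivatives of matrix-valued functions, entry by entry\<close>

lemma has_vector_derivative_matrix_nth:
  fixes M :: "real \<Rightarrow> complex^2^2"
  assumes "(M has_vector_derivative M') F"
  shows "((\<lambda>s. M s $ i $ j) has_vector_derivative M' $ i $ j) F"
  by (intro bounded_linear.has_vector_derivative[OF bounded_linear_vec_nth] assms)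

lemma has_vector_derivative_matrixI:
  fixes M :: "real \<Rightarrow> complex^2^2"
  assumes "\<And>i j. ((\<lambda>s. M s $ i $ j) has_vector_derivative M' $ i $ j) F"
  shows "(M has_vector_derivative M') F"
proof -
  have lin: "bounded_linear (\<lambda>c. cscale c (ketbra i j))" for i j
    by (intro linear_conv_bounded_linear[THEN iffD1] linearI)
      (simp_all add: cscale_def vec_eq_iff algebra_simps)
  have eq: "A = (\<Sum>i\<in>UNIV. \<Sum>j\<in>UNIV. cscale (A $ i $ j) (ketbra i j))" for A
    by (simp add: sum_2_01 mat2_eq_iff cscale_def ketbra_def)
  have "((\<lambda>s. \<Sum>i\<in>UNIV. \<Sum>j\<in>UNIV. cscale (M s $ i $ j) (ketbra i j)) has_vector_derivative
     (\<Sum>i\<in>UNIV. \<Sum>j\<in>UNIV. cscale (M' $ i $ j) (ketbra i j))) F"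
    by (intro has_vector_derivative_sum bounded_linear.has_vector_derivative[OF lin] assms)
  then show ?thesis by (simp flip: eq)
qed

section \<open>Derivative of the entropy\<close>

lemma has_vector_derivative_of_real_Re:
  fixes f :: "real \<Rightarrow> complex"
  assumes "(f has_vector_derivative f') (at t)" and "\<And>s. f s = of_real (Re (f s))"
  shows "((\<lambda>s. Re (f s)) has_real_derivative Re f') (at t)" "f' = of_real (Re f')"
proof -
  have R: "((\<lambda>s. Re (f s)) has_vector_derivative Re f') (at t)"
    by (intro bounded_linear.has_vector_derivative[OF bounded_linear_Re] assms)
  then show "((\<lambda>s. Re (f s)) has_real_derivative Re f') (at t)"
    by (simp add: has_real_derivative_iff_has_vector_derivative)
  have "((\<lambda>s. of_real (Re (f s)) :: complex) has_vector_derivative of_real (Re f')) (at t)"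
    by (intro bounded_linear.has_vector_derivative[OF bounded_linear_of_real] R)
  then have "(f has_vector_derivative of_real (Re f')) (at t)"
    by (simp flip: assms(2))
  then show "f' = of_real (Re f')"
    using assms(1) vector_derivative_unique_at by blast
qed

text \<open>The norm is not differentiable at 0, but the vanishing derivative of \<open>h\<close>
  gives h |x| - h 0 = o(|x|), so the composite is differentiable there with derivative 0. This
  treats coinciding eigenvalues.\<close>

lemma has_derivative_compose_norm:
  fixes h :: "real \<Rightarrow> real" and w :: "real \<Rightarrow> 'a::real_inner"
  assumes h: "(h has_real_derivative 0) (at 0)"
    and w: "(w has_vector_derivative w') (at t)" "w t = 0"
  shows "((\<lambda>s. h (norm (w s))) has_real_derivative 0) (at t)"
proof -
  have "((\<lambda>x::'a. h (norm x)) has_derivative (\<lambda>_. 0)) (at 0)"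
  proof -
    have "((\<lambda>x. norm (h (0 + x) - h 0 - 0 * x) / norm x) \<longlongrightarrow> 0) (at 0)"
      using h unfolding has_field_derivative_def has_derivative_at by blast
    moreover have "filterlim (norm :: 'a \<Rightarrow> real) (at 0) (at 0)"
      by (auto simp: filterlim_at eventually_at_filter intro!: tendsto_eq_intros)
    ultimately have "((\<lambda>x::'a. norm (h (0 + norm x) - h 0 - 0 * norm x) / norm (norm x)) \<longlongrightarrow> 0) (at 0)"
      by (rule filterlim_compose)
    then show ?thesis
      by (simp only: has_derivative_at bounded_linear_zero add_0 mult_zero_left norm_zero real_norm_def abs_norm_cancel simp_thms)
  qed
  then have "((\<lambda>s. h (norm (w s))) has_derivative (\<lambda>x. 0)) (at t)"
    using has_derivative_compose[of w "\<lambda>x. x *\<^sub>R w'" t UNIV "\<lambda>x. h (norm x)" "\<lambda>_. 0"] w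
    by (simp add: has_vector_derivative_def)
  then show ?thesis by (simp add: has_field_derivative_def lambda_zero)
qed

text \<open>The real logarithm is totalised as an even function.\<close>

lemma DERIV_ln_nonzero:
  fixes x :: real
  assumes "x \<noteq> 0"
  shows "(ln has_real_derivative 1 / x) (at x)"
proof (cases "x > 0")
  case True
  then show ?thesis by (rule DERIV_ln_divide)
next
  case False
  with assms have "- x > 0" by simp
  then have "((\<lambda>y. ln (- y)) has_real_derivative 1 / x) (at x)"
    by (auto intro!: derivative_eq_intros)
  then show ?thesis by (simp add: ln_minus)
qed

text \<open>The eigenvalues are (1 + r) / 2 and (1 - r) / 2 with r^2 = 1 - 4 det, so both sides can
  be expressed by the derivative \<open>D\<close> of the determinant and the divided difference
  \<open>y\<close> of the logarithm: both equal y * Re D.\<close>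

lemma has_vector_derivative_entropy:
  fixes \<rho> :: "real \<Rightarrow> complex^2^2"
  assumes herm: "\<And>s. cadj (\<rho> s) = \<rho> s" and tr: "\<And>s. trace (\<rho> s) = 1"
    and der: "(\<rho> has_vector_derivative \<rho>') (at t)" and inv: "invertible (\<rho> t)"
  shows "((\<lambda>s. - trace (\<rho> s ** mat_ln (\<rho> s))) has_vector_derivative
    - trace (\<rho>' ** mat_ln (\<rho> t))) (at t)"
proof -
  define \<delta> where "\<delta> = (\<lambda>s. Re (det (\<rho> s)))"
  \<comment> \<open>The Bloch vector up to signs, its two transverse components packed into one
    complex number; \<open>r\<close> is its length.\<close>
  define w where "w = (\<lambda>s. (\<rho> s $ 0 $ 0 - \<rho> s $ 1 $ 1, 2 * \<rho> s $ 0 $ 1))"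
  define r where "r = (\<lambda>s. norm (w s))"
  define D where "D = \<rho> t $ 0 $ 0 * \<rho>' $ 1 $ 1 + \<rho>' $ 0 $ 0 * \<rho> t $ 1 $ 1
    - (\<rho> t $ 0 $ 1 * \<rho>' $ 1 $ 0 + \<rho>' $ 0 $ 1 * \<rho> t $ 1 $ 0)"
  define h where "h = (\<lambda>x::real. (1 + x) / 2 * ln ((1 + x) / 2) + (1 - x) / 2 * ln ((1 - x) / 2))"
  note nth = has_vector_derivative_matrix_nth[OF der]
  have det: "det (\<rho> s) = of_real (\<delta> s)" and r2: "(r s)\<^sup>2 = 1 - 4 * \<delta> s" for s
  proof -
    define a c b where "a = Re (\<rho> s $ 0 $ 0)" and "c = Re (\<rho> s $ 1 $ 1)" and "b = \<rho> s $ 0 $ 1"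
    have A: "\<rho> s $ 0 $ 0 = of_real a" "\<rho> s $ 1 $ 1 = of_real c" "\<rho> s $ 0 $ 1 = b" "\<rho> s $ 1 $ 0 = cnj b"
      using hermitian_entries[OF herm[of s]] by (simp_all add: a_def b_def c_def)
    have "of_real (a + c) = complex_of_real 1"
      using tr[of s] by (simp add: trace_2_01 A)
    then have ac: "c = 1 - a" unfolding of_real_eq_iff by simp
    have d: "det (\<rho> s) = of_real (a * c - (cmod b)\<^sup>2)"
      using complex_norm_square[of b] by (simp add: det_2_01 A)
    then show "det (\<rho> s) = of_real (\<delta> s)" by (simp add: \<delta>_def)
    have "\<delta> s = a * c - (cmod b)\<^sup>2" by (simp add: \<delta>_def d)
    moreover have "(r s)\<^sup>2 = (a - c)\<^sup>2 + 4 * (cmod b)\<^sup>2"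
      by (simp add: r_def w_def norm_Pair A norm_mult power_mult_distrib flip: of_real_diff)
    ultimately show "(r s)\<^sup>2 = 1 - 4 * \<delta> s"
      unfolding ac by (simp add: power2_eq_square algebra_simps)
  qed
  have trdet: "trace (\<rho> s) = of_real ((1 + r s) / 2 + (1 - r s) / 2)"
    "det (\<rho> s) = of_real ((1 + r s) / 2 * ((1 - r s) / 2))" for s
  proof -
    have "(1 + r s) / 2 * ((1 - r s) / 2) = \<delta> s"
      using r2[of s] by (simp add: power2_eq_square field_simps)
    then show "det (\<rho> s) = of_real ((1 + r s) / 2 * ((1 - r s) / 2))" by (simp only: det)
    have "(1 + r s) / 2 + (1 - r s) / 2 = 1" by (simp add: field_simps)
    then show "trace (\<rho> s) = of_real ((1 + r s) / 2 + (1 - r s) / 2)"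
      by (simp only: tr of_real_1)
  qed
  have S: "trace (\<rho> s ** mat_ln (\<rho> s)) = of_real (h (r s))" for s
    unfolding mat_ln_def trace_mult_herm_fun[OF herm trdet] h_def ..
  \<comment> \<open>Invertibility makes both eigenvalues nonzero, as \<open>DERIV_ln_nonzero\<close>
    demands.\<close>
  have "(det (\<rho> t)) \<noteq> 0" using inv by (simp add: invertible_det_nz)
  then have \<delta>t: "(1 + r t) / 2 \<noteq> 0" "(1 - r t) / 2 \<noteq> 0"
    unfolding trdet of_real_eq_0_iff mult_eq_0_iff by blast+
  have tr': "trace \<rho>' = 0"
  proof -
    have "((\<lambda>s. trace (\<rho> s)) has_vector_derivative trace \<rho>') (at t)"
      unfolding trace_2_01 by (intro has_vector_derivative_add nth)
    then show ?thesis
      unfolding tr using vector_derivative_unique_at has_vector_derivative_const by blast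
  qed
  have detD: "((\<lambda>s. det (\<rho> s)) has_vector_derivative D) (at t)"
    unfolding det_2_01 D_def
    by (intro has_vector_derivative_diff has_vector_derivative_mult nth)
  have \<delta>D: "(\<delta> has_real_derivative Re D) (at t)" and D: "D = of_real (Re D)"
    unfolding \<delta>_def
    by (rule has_vector_derivative_of_real_Re[OF detD], simp add: det)+
  obtain x y where f: "ln ((1 + r t) / 2) = x + y * ((1 + r t) / 2)"
      "ln ((1 - r t) / 2) = x + y * ((1 - r t) / 2)"
    and y: "y = (ln ((1 + r t) / 2) - ln ((1 - r t) / 2)) / ((1 + r t) / 2 - (1 - r t) / 2)"
    using affine_interpolation[of ln "(1 + r t) / 2" "(1 - r t) / 2"] by blast
  have lnt: "mat_ln (\<rho> t) = cscale x (mat 1) + cscale y (\<rho> t)"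
    unfolding mat_ln_def by (rule herm_fun_affine[OF herm trdet f])
  \<comment> \<open>Half the derivative of Tr A^2 = (Tr A)^2 - 2 det A along the path.\<close>
  have "trace (\<rho>' ** \<rho> t) = trace \<rho>' * trace (\<rho> t) - D"
    by (simp add: trace_2_01 mult_2_01 D_def algebra_simps)
  then have "trace (\<rho>' ** \<rho> t) = - D" by (simp add: tr')
  moreover have "trace (\<rho>' ** mat_ln (\<rho> t)) = x * trace \<rho>' + y * trace (\<rho>' ** \<rho> t)"
    by (simp add: lnt trace_2_01 mult_2_01 cscale_def mat_def algebra_simps)
  ultimately have T: "trace (\<rho>' ** mat_ln (\<rho> t)) = of_real (- y * Re D)"
    using tr' D by simp
  have "((\<lambda>s. h (r s)) has_real_derivative - y * Re D) (at t)"
  proof (cases "r t = 0")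
    \<comment> \<open>The eigenvalues cross and \<open>r\<close> need not be differentiable, but \<open>r\<close> is the norm of the
      differentiable \<open>w\<close>, and \<open>h\<close> has a critical point at \<open>0\<close>.\<close>
    case True
    have "(h has_real_derivative 0) (at 0)"
      unfolding h_def by (auto intro!: derivative_eq_intros simp flip: add_divide_distrib)
    moreover have "(w has_vector_derivative
        (\<rho>' $ 0 $ 0 - \<rho>' $ 1 $ 1, 2 * \<rho>' $ 0 $ 1)) (at t)"
      unfolding w_def
      by (intro has_vector_derivative_Pair has_vector_derivative_diff
          has_vector_derivative_mult_right nth)
    ultimately have "((\<lambda>s. h (norm (w s))) has_real_derivative 0) (at t)"
      by (rule has_derivative_compose_norm) (use True in \<open>simp add: r_def\<close>)
    \<comment> \<open>For \<open>r t = 0\<close> the two logarithms coincide, so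
      \<open>y = 0\<close> and the target derivative is 0 as well.\<close>
    then show ?thesis using True y by (simp add: r_def)
  next
    case False
    have rs: "r s = sqrt (1 - 4 * \<delta> s)" for s
      using r2[of s, symmetric] by (simp add: r_def)
    have "r t > 0" using False by (simp add: r_def)
    then have pos: "1 - 4 * \<delta> t > 0" unfolding r2[symmetric] by simp
    have rD: "(r has_real_derivative - 2 * Re D / r t) (at t)"
    proof -
      have "((\<lambda>s. 1 - 4 * \<delta> s) has_real_derivative - (4 * Re D)) (at t)"
        by (auto intro!: derivative_eq_intros \<delta>D)
      from DERIV_chain2[OF DERIV_real_sqrt[OF pos] this] show ?thesis
        unfolding rs[symmetric] by (rule DERIV_cong) (simp add: field_simps)
    qed
    \<comment> \<open>The contributions of the summand 1 will cancel, since the two eigenvalues have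
      opposite derivatives.\<close>
    have G: "((\<lambda>s. q s * ln (q s)) has_real_derivative q' * (ln (q t) + 1)) (at t)"
      if "(q has_real_derivative q') (at t)" "q t \<noteq> 0" for q :: "real \<Rightarrow> real" and q'
      using DERIV_mult[OF that(1) DERIV_chain2[OF DERIV_ln_nonzero[OF that(2)] that(1)]] that(2)
      by (simp add: algebra_simps)
    have pD: "((\<lambda>s. (1 + r s) / 2) has_real_derivative (- 2 * Re D / r t) / 2) (at t)"
      "((\<lambda>s. (1 - r s) / 2) has_real_derivative - ((- 2 * Re D / r t) / 2)) (at t)"
      by (auto intro!: derivative_eq_intros rD)
    have "((\<lambda>s. h (r s)) has_real_derivative
       (- 2 * Re D / r t) / 2 * (ln ((1 + r t) / 2) - ln ((1 - r t) / 2))) (at t)"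
      unfolding h_def
      by (rule derivative_eq_intros G[OF pD(1)] G[OF pD(2)] \<delta>t)+ (simp add: algebra_simps)
    moreover have "(- 2 * Re D / r t) / 2 * (ln ((1 + r t) / 2) - ln ((1 - r t) / 2)) = - y * Re D"
      unfolding y using False by (simp add: field_simps)
    ultimately show ?thesis by simp
  qed
  then have "((\<lambda>s. complex_of_real (h (r s))) has_vector_derivative of_real (- y * Re D)) (at t)"
    unfolding has_real_derivative_iff_has_vector_derivative
    by (rule bounded_linear.has_vector_derivative[OF bounded_linear_of_real])
  then show ?thesis
    unfolding S T by (rule has_vector_derivative_minus)
qed

section \<open>Operators on the mode\<close>

text \<open>Collapses the infinite matrix product: the rows or columns to which it is applied have
  at most two nonzero entries.\<close>

lemma op_mult_finite:
  assumes "finite F" "\<And>k. k \<notin> F \<Longrightarrow> A i k * B k j = 0"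
  shows "(A \<odot> B) i j = (\<Sum>k\<in>F. A i k * B k j)"
proof -
  have "(A \<odot> B) i j = infsum (\<lambda>k. A i k * B k j) F"
    unfolding op_mult_def by (intro infsum_cong_neutral) (use assms in auto)
  then show ?thesis using assms(1) by simp
qed

definition op_diag :: "('i \<Rightarrow> complex) \<Rightarrow> 'i op" where
  "op_diag d = (\<lambda>i j. if i = j then d i else 0)"

lemma op_diag_mult: "(op_diag d \<odot> B) i j = d i * B i j" "(B \<odot> op_diag d) i j = B i j * d j"
proof -
  have "(op_diag d \<odot> B) i j = (\<Sum>k\<in>{i}. op_diag d i k * B k j)"
    "(B \<odot> op_diag d) i j = (\<Sum>k\<in>{j}. B i k * op_diag d k j)"
    by (intro op_mult_finite; simp add: op_diag_def)+
  then show "(op_diag d \<odot> B) i j = d i * B i j" "(B \<odot> op_diag d) i j = B i j * d j"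
    by (simp_all add: op_diag_def)
qed

lemma op_pow_diag: "op_pow (op_diag d) k = op_diag (\<lambda>i. d i ^ k)"
  by (induction k) (simp_all add: fun_eq_iff op_diag_mult, simp_all add: op_one_def op_diag_def)

lemma exp_sums: "(\<lambda>k. z ^ k / fact k) sums exp (z :: complex)"
proof -
  have "(\<lambda>k. z ^ k /\<^sub>R fact k) = (\<lambda>k. z ^ k / fact k)"
    by (simp add: fun_eq_iff scaleR_conv_of_real field_simps)
  then show ?thesis using exp_converges[of z] by simp
qed

lemma op_exp_diag: "op_exp (op_diag d) = op_diag (\<lambda>i. exp (d i))"
  unfolding op_exp_def op_pow_diag
  by (auto simp: fun_eq_iff op_diag_def sums_iff[THEN iffD1, OF exp_sums])

lemma H_B_diag: "H_B \<omega>B = op_diag (\<lambda>n. of_real (\<omega>B * real n))"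
proof -
  have "(op_adj ann \<odot> ann) m n = op_diag of_nat m n" for m n
  proof -
    \<comment> \<open>Row \<open>m\<close> of \<open>op_adj ann\<close> is supported at column
      \<open>m - 1\<close>; for \<open>m = 0\<close> truncated subtraction gives 0, and that row
      vanishes.\<close>
    have "(op_adj ann \<odot> ann) m n = (\<Sum>k\<in>{m - 1}. op_adj ann m k * ann k n)"
      by (intro op_mult_finite) (auto simp: op_adj_def ann_def)
    also have "\<dots> = op_diag of_nat m n"
      by (cases m) (auto simp: op_adj_def ann_def op_diag_def simp flip: of_real_mult)
    finally show ?thesis .
  qed
  then show ?thesis by (simp add: H_B_def op_scale_def fun_eq_iff, simp add: op_diag_def)
qed

definition thermal_weight :: "real \<Rightarrow> real \<Rightarrow> nat \<Rightarrow> real" where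
  "thermal_weight \<omega>B \<beta>B n = exp (- real n * \<beta>B * \<omega>B) / Z_B \<omega>B \<beta>B"

lemma thermal_weight_Suc:
  "thermal_weight \<omega>B \<beta>B (Suc n) = exp (- \<beta>B * \<omega>B) * thermal_weight \<omega>B \<beta>B n"
  by (simp add: thermal_weight_def algebra_simps flip: exp_add)

lemma thermal_weight_geometric:
  "thermal_weight \<omega>B \<beta>B n = (1 - exp (- \<beta>B * \<omega>B)) * exp (- \<beta>B * \<omega>B) ^ n"
proof (induction n)
  case 0
  then show ?case by (simp add: thermal_weight_def Z_B_def mult.commute)
qed (simp add: thermal_weight_Suc)

lemma thermal_diag:
  assumes "\<omega>B > 0" "\<beta>B > 0"
  shows "thermal \<omega>B \<beta>B = op_diag (\<lambda>n. of_real (thermal_weight \<omega>B \<beta>B n))"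
proof -
  define q where "q = exp (- \<beta>B * \<omega>B)"
  have q: "0 < q" "q < 1" using assms by (auto simp: q_def)
  have "op_scale (- \<beta>B) (H_B \<omega>B) = op_diag (\<lambda>n. of_real (real n * (- \<beta>B * \<omega>B)))"
    by (auto simp: H_B_diag op_scale_def op_diag_def fun_eq_iff)
  then have G: "op_exp (op_scale (- \<beta>B) (H_B \<omega>B)) = op_diag (\<lambda>n. of_real (q ^ n))"
    unfolding q_def exp_of_nat_mult[symmetric]
    by (simp only: op_exp_diag exp_of_real)
  have "(\<lambda>n. q ^ n) sums (1 / (1 - q))" using q by (intro geometric_sums) auto
  then have "((\<lambda>n. q ^ n) has_sum (1 / (1 - q))) UNIV"
    using q by (intro sums_nonneg_imp_has_sum) auto
  then have "((\<lambda>n. complex_of_real (q ^ n)) has_sum of_real (1 / (1 - q))) UNIV"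
    by (rule has_sum_of_real)
  then have "op_trace (op_diag (\<lambda>n. of_real (q ^ n))) = of_real (1 / (1 - q))"
    unfolding op_trace_def op_diag_def by (simp add: infsumI)
  then show ?thesis
    unfolding thermal_def Let_def G
    by (auto simp: op_scale_def op_diag_def fun_eq_iff thermal_weight_geometric q_def)
qed

lemma thermal_weight_sums:
  assumes "\<omega>B > 0" "\<beta>B > 0"
  shows "thermal_weight \<omega>B \<beta>B sums 1"
  unfolding thermal_weight_geometric[abs_def]
  using sums_mult[OF geometric_sums[of "exp (- \<beta>B * \<omega>B)"], of "1 - exp (- \<beta>B * \<omega>B)"] assms by simp

section \<open>Diagonalisation of the Jaynes--Cummings Hamiltonian\<close>

text \<open>The number of excitations is conserved; \<open>ptn p\<close> is the other basis state with the same
  number.  The ground state has none, and its junk value does no harm because the corresponding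
  matrix element carries the factor \<open>\<surd>0\<close>.\<close>

definition lvl :: "2 \<times> nat \<Rightarrow> nat" where
  "lvl p = (if fst p = 1 then Suc (snd p) else snd p)"

definition ptn :: "2 \<times> nat \<Rightarrow> 2 \<times> nat" where
  "ptn p = (if fst p = 1 then (0, Suc (snd p)) else (1, snd p - 1))"

lemma two_cases:
  fixes i :: 2
  obtains "i = 0" | "i = 1"
  using all_2[of "\<lambda>i. i = 0 \<or> i = 1"] by auto

lemma two_times_nat_cases:
  fixes p :: "2 \<times> nat"
  obtains (ground) "p = (0, 0)" | (lower) n where "p = (0, Suc n)" | (upper) n where "p = (1, n)"
proof -
  obtain i n where p: "p = (i, n)" by (cases p)
  show ?thesis
    by (cases i rule: two_cases; cases n) (use p that in auto)
qed

lemma ptn_simps [simp]: "ptn (1, n) = (0, Suc n)" "ptn (0, Suc n) = (1, n)" "ptn (0, 0) = (1, 0)"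
  by (simp_all add: ptn_def)

lemma lvl_simps [simp]: "lvl (1, n) = Suc n" "lvl (0, n) = n"
  by (simp_all add: lvl_def)

lemma ptn_neq [simp]: "ptn p \<noteq> p" "p \<noteq> ptn p"
  by (cases p rule: two_times_nat_cases; simp)+

text \<open>Mean of the bare energies \<omega>B * N and \<omega>A + \<omega>B * (N - 1) of a sector.
  The formula also fits N = 0, where adding the detuning of the ground state gives energy 0.\<close>

definition jc_energy :: "real \<Rightarrow> real \<Rightarrow> nat \<Rightarrow> real" where
  "jc_energy \<omega>A \<omega>B N = \<omega>B * real N + (\<omega>A - \<omega>B) / 2"

definition jc_detuning :: "real \<Rightarrow> real \<Rightarrow> 2 \<times> nat \<Rightarrow> real" where
  "jc_detuning \<omega>A \<omega>B p = (if fst p = 1 then (\<omega>A - \<omega>B) / 2 else - ((\<omega>A - \<omega>B) / 2))"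

definition jc_coupling :: "real \<Rightarrow> 2 \<times> nat \<Rightarrow> real" where
  "jc_coupling g p = g * sqrt (real (lvl p))"

text \<open>The traceless part of the Hamiltonian in each excitation sector.\<close>

definition jc_mix :: "real \<Rightarrow> real \<Rightarrow> real \<Rightarrow> 2 \<times> nat \<Rightarrow> 2 \<times> nat \<Rightarrow> real" where
  "jc_mix \<omega>A \<omega>B g p l =
     (if l = p then jc_detuning \<omega>A \<omega>B p else if l = ptn p then jc_coupling g p else 0)"

text \<open>A traceless symmetric block with diagonal k, - k and off-diagonal entry c squares to k^2
  + c^2; hence its eigenvalues are plus and minus half the Rabi frequency.\<close>

lemma detuning_coupling_squares:
  "(jc_detuning \<omega>A \<omega>B p)\<^sup>2 + (jc_coupling g p)\<^sup>2 = (rabi \<omega>A \<omega>B g (lvl p) / 2)\<^sup>2"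
  by (simp add: jc_detuning_def jc_coupling_def rabi_def power_divide power_mult_distrib
      add_divide_distrib power2_commute[of \<omega>B \<omega>A])

lemma H_AB_entries:
  "H_AB \<omega>A \<omega>B g p l = of_real ((if l = p then jc_energy \<omega>A \<omega>B (lvl p) else 0) + jc_mix \<omega>A \<omega>B g p l)"
proof -
  obtain i m j n where pl: "p = (i, m)" "l = (j, n)" by (cases p, cases l)
  show ?thesis
    unfolding pl
    by (cases i rule: two_cases; cases j rule: two_cases; cases m)
      (auto simp: H_AB_def H_B_diag op_add_def op_scale_def tens_def sigma_plus_def sigma_minus_def
        ketbra_def mult_2_01 op_one_def ann_def op_adj_def op_diag_def mat_def jc_mix_def jc_energy_def
        jc_detuning_def jc_coupling_def field_simps)
qed

lemma H_AB_mult: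
  fixes z :: complex and X :: "(2 \<times> nat) op"
  shows "(op_scale z (H_AB \<omega>A \<omega>B g) \<odot> X) p l =
    z * ((jc_energy \<omega>A \<omega>B (lvl p) + jc_detuning \<omega>A \<omega>B p) * X p l + jc_coupling g p * X (ptn p) l)"
proof -
  have "(op_scale z (H_AB \<omega>A \<omega>B g) \<odot> X) p l
    = (\<Sum>k\<in>{p, ptn p}. op_scale z (H_AB \<omega>A \<omega>B g) p k * X k l)"
    by (intro op_mult_finite) (auto simp: op_scale_def H_AB_entries jc_mix_def)
  then show ?thesis
    by (simp add: op_scale_def H_AB_entries jc_mix_def algebra_simps)
qed

text \<open>For \<open>s = \<plusminus>1\<close>, the projection onto the dressed states of energy \<open>E + s R\<close>, where \<open>R\<close> is half the
  Rabi frequency; if \<open>R = 0\<close>, division by zero makes both of them half the identity.\<close>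

definition jc_proj :: "real \<Rightarrow> real \<Rightarrow> real \<Rightarrow> real \<Rightarrow> 2 \<times> nat \<Rightarrow> 2 \<times> nat \<Rightarrow> real" where
  "jc_proj \<omega>A \<omega>B g s p l =
    ((if l = p then 1 else 0) + s * jc_mix \<omega>A \<omega>B g p l / (rabi \<omega>A \<omega>B g (lvl p) / 2)) / 2"

definition jc_level :: "real \<Rightarrow> real \<Rightarrow> real \<Rightarrow> real \<Rightarrow> nat \<Rightarrow> real" where
  "jc_level \<omega>A \<omega>B g s N = jc_energy \<omega>A \<omega>B N + s * (rabi \<omega>A \<omega>B g N / 2)"

text \<open>The traceless block M satisfies M^2 = R^2, hence M (1 + s M / R) = s R (1 + s M / R);
  for R = 0 the block M itself vanishes.\<close>

lemma jc_eigen: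
  assumes "s\<^sup>2 = 1"
  shows "(jc_energy \<omega>A \<omega>B (lvl p) + jc_detuning \<omega>A \<omega>B p) * jc_proj \<omega>A \<omega>B g s p l
     + jc_coupling g p * jc_proj \<omega>A \<omega>B g s (ptn p) l
    = jc_level \<omega>A \<omega>B g s (lvl p) * jc_proj \<omega>A \<omega>B g s p l"
proof -
  define R where "R = rabi \<omega>A \<omega>B g (lvl p) / 2"
  define k where "k = jc_detuning \<omega>A \<omega>B p"
  define c where "c = jc_coupling g p"
  define E where "E = jc_energy \<omega>A \<omega>B (lvl p)"
  have kc: "k\<^sup>2 + c\<^sup>2 = R\<^sup>2"
    using detuning_coupling_squares by (simp add: k_def c_def R_def)
  have p1: "jc_proj \<omega>A \<omega>B g s p l = ((if l = p then 1 else 0) +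
      s * (if l = p then k else if l = ptn p then c else 0) / R) / 2"
    by (simp add: jc_proj_def jc_mix_def k_def c_def R_def)
  \<comment> \<open>The factor c stays in the statement: the junk partner of the ground state lies
    in sector 1, and the formula for its projection holds only after multiplication by c =
    0.\<close>
  have p2: "c * jc_proj \<omega>A \<omega>B g s (ptn p) l = c * (((if l = ptn p then 1 else 0) +
      s * (if l = p then c else if l = ptn p then - k else 0) / R) / 2)"
    by (cases p rule: two_times_nat_cases)
      (auto simp: jc_proj_def jc_mix_def k_def c_def R_def jc_coupling_def jc_detuning_def)
  have "(E + k) * jc_proj \<omega>A \<omega>B g s p l + c * jc_proj \<omega>A \<omega>B g s (ptn p) l
     = (E + s * R) * jc_proj \<omega>A \<omega>B g s p l"
  proof (cases "R = 0")
    case True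
    then have "k = 0" "c = 0" using kc by simp_all
    then show ?thesis unfolding p1 p2 using True by simp
  next
    case False
    define a b where "a = k / R" and "b = c / R"
    have kcR: "k = a * R" "c = b * R" using False by (simp_all add: a_def b_def)
    have "(a\<^sup>2 + b\<^sup>2) * R\<^sup>2 = 1 * R\<^sup>2" using kc by (simp add: kcR algebra_simps)
    then have ab: "a * a + b * b = 1" using False by (simp add: power2_eq_square)
    have ss: "s * s = 1" using assms by (simp add: power2_eq_square)
    have diag: "(E + a * R) * (1 + s * a) + b * R * (s * b) = (E + s * R) * (1 + s * a)"
    proof -
      have "(E + a * R) * (1 + s * a) + b * R * (s * b)
        = E + a * R + s * E * a + s * R * (a * a + b * b)" by (simp add: algebra_simps)
      also have "\<dots> = E + s * R + s * E * a + (s * s) * a * R" by (simp add: ab ss)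
      finally show ?thesis by (simp add: algebra_simps)
    qed
    have off: "(E + a * R) * (s * b) + b * R * (1 - s * a) = (E + s * R) * (s * b)"
    proof -
      have "(E + a * R) * (s * b) + b * R * (1 - s * a) = E * (s * b) + (s * s) * R * b"
        by (simp add: ss algebra_simps)
      then show ?thesis by (simp add: algebra_simps)
    qed
    show ?thesis unfolding p1 p2 unfolding kcR using False diag off
      by (auto simp: add_divide_distrib[symmetric])
  qed
  then show ?thesis by (simp only: jc_level_def E_def k_def c_def R_def)
qed

lemma jc_proj_sum: "jc_proj \<omega>A \<omega>B g 1 p l + jc_proj \<omega>A \<omega>B g (- 1) p l = (if l = p then 1 else 0)"
  by (simp add: jc_proj_def flip: add_divide_distrib)

lemma jc_proj_support: "l \<noteq> p \<Longrightarrow> l \<noteq> ptn p \<Longrightarrow> jc_proj \<omega>A \<omega>B g s p l = 0"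
  by (simp add: jc_proj_def jc_mix_def)

text \<open>Completeness \<open>jc_proj_sum\<close> starts the induction and the eigenvalue equation
  \<open>jc_eigen\<close> advances it; \<open>p\<close> is arbitrary because one step involves the
  row of the partner.\<close>

lemma op_pow_H_AB:
  "op_pow (op_scale z (H_AB \<omega>A \<omega>B g)) k p l =
    (\<Sum>s\<in>{1, - 1}. (z * jc_level \<omega>A \<omega>B g s (lvl p)) ^ k * jc_proj \<omega>A \<omega>B g s p l)"
proof (induction k arbitrary: p)
  case 0
  have "op_pow (op_scale z (H_AB \<omega>A \<omega>B g)) 0 p l
      = of_real (jc_proj \<omega>A \<omega>B g 1 p l + jc_proj \<omega>A \<omega>B g (- 1) p l)"
    unfolding jc_proj_sum by (simp add: op_one_def)
  then show ?case by simp
next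
  case (Suc k)
  let ?w = "\<lambda>s. z * jc_level \<omega>A \<omega>B g s (lvl p)"
  let ?P = "\<lambda>s. complex_of_real (jc_proj \<omega>A \<omega>B g s p l)"
  let ?P' = "\<lambda>s. complex_of_real (jc_proj \<omega>A \<omega>B g s (ptn p) l)"
  let ?h = "complex_of_real (jc_energy \<omega>A \<omega>B (lvl p) + jc_detuning \<omega>A \<omega>B p)"
  let ?c = "complex_of_real (jc_coupling g p)"
  \<comment> \<open>The partner has the same excitation number, hence the same levels; for the
    ground state it does not, but there \<open>?c\<close> is zero.\<close>
  have lvl: "?c * op_pow (op_scale z (H_AB \<omega>A \<omega>B g)) k (ptn p) l
      = ?c * (\<Sum>s\<in>{1, - 1}. ?w s ^ k * ?P' s)"
    unfolding Suc.IH by (cases p rule: two_times_nat_cases) (auto simp: jc_coupling_def)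
  have eig: "?h * ?P s + ?c * ?P' s = jc_level \<omega>A \<omega>B g s (lvl p) * ?P s" if "s\<^sup>2 = 1" for s
    using arg_cong[OF jc_eigen[OF that, of \<omega>A \<omega>B p g l], of complex_of_real] by simp
  have "op_pow (op_scale z (H_AB \<omega>A \<omega>B g)) (Suc k) p l
     = z * (?h * (\<Sum>s\<in>{1, - 1}. ?w s ^ k * ?P s) + ?c * (\<Sum>s\<in>{1, - 1}. ?w s ^ k * ?P' s))"
    unfolding op_pow.simps unfolding H_AB_mult lvl unfolding Suc.IH by (simp only: of_real_add)
  also have "\<dots> = (\<Sum>s\<in>{1, - 1}. ?w s ^ k * (z * (?h * ?P s + ?c * ?P' s)))"
    unfolding sum_distrib_left sum.distrib[symmetric]
    by (intro sum.cong refl) (simp only: algebra_simps)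
  also have "\<dots> = (\<Sum>s\<in>{1, - 1}. ?w s ^ Suc k * ?P s)"
  proof (intro sum.cong refl)
    fix s :: real
    assume "s \<in> {1, - 1}"
    then have "s\<^sup>2 = 1" by auto
    then show "?w s ^ k * (z * (?h * ?P s + ?c * ?P' s)) = ?w s ^ Suc k * ?P s"
      unfolding eig[OF \<open>s\<^sup>2 = 1\<close>] by (simp only: power_Suc mult_ac)
  qed
  finally show ?case .
qed

lemma U_AB_entries:
  "U_AB \<omega>A \<omega>B g t p l =
    (\<Sum>s\<in>{1, - 1}. exp (- \<i> * t * jc_level \<omega>A \<omega>B g s (lvl p)) * jc_proj \<omega>A \<omega>B g s p l)"
proof -
  have "(\<lambda>k. \<Sum>s\<in>{1, - 1}. (- \<i> * t * jc_level \<omega>A \<omega>B g s (lvl p)) ^ k / fact k * jc_proj \<omega>A \<omega>B g s p l)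
    sums (\<Sum>s\<in>{1, - 1}. exp (- \<i> * t * jc_level \<omega>A \<omega>B g s (lvl p)) * jc_proj \<omega>A \<omega>B g s p l)"
    by (intro sums_sum sums_mult2 exp_sums)
  then show ?thesis
    unfolding U_AB_def op_exp_def op_pow_H_AB sum_divide_distrib
    by (simp add: sums_iff)
qed

lemma U_AB_support: "l \<noteq> p \<Longrightarrow> l \<noteq> ptn p \<Longrightarrow> U_AB \<omega>A \<omega>B g t p l = 0"
  by (simp add: U_AB_entries jc_proj_support)

text \<open>The mean energy of a sector contributes a common phase, which drops out of all
  populations; the two phases around it combine into cosine and sine.\<close>

lemma U_AB_trig:
  fixes \<omega>A \<omega>B g t :: real
  defines "R \<equiv> \<lambda>p. rabi \<omega>A \<omega>B g (lvl p) / 2"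
  shows "U_AB \<omega>A \<omega>B g t p p = exp (- \<i> * t * jc_energy \<omega>A \<omega>B (lvl p)) *
      Complex (cos (R p * t)) (- (jc_detuning \<omega>A \<omega>B p / R p * sin (R p * t)))" (is ?th1)
    and "U_AB \<omega>A \<omega>B g t p (ptn p) = exp (- \<i> * t * jc_energy \<omega>A \<omega>B (lvl p)) *
      Complex 0 (- (jc_coupling g p / R p * sin (R p * t)))" (is ?th2)
proof -
  have e: "exp (- \<i> * t * jc_level \<omega>A \<omega>B g s (lvl p))
      = exp (- \<i> * t * jc_energy \<omega>A \<omega>B (lvl p)) * cis (- (s * (R p * t)))" for s
    by (simp add: jc_level_def R_def cis_conv_exp algebra_simps flip: exp_add)
  have proj: "jc_proj \<omega>A \<omega>B g s p p = (1 + s * (jc_detuning \<omega>A \<omega>B p / R p)) / 2"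
    "jc_proj \<omega>A \<omega>B g s p (ptn p) = (s * (jc_coupling g p / R p)) / 2" for s
    by (simp_all add: jc_proj_def jc_mix_def R_def)
  have trig: "(\<Sum>s\<in>{1, - 1}. x * cis (- (s * \<theta>)) * complex_of_real ((b + s * a) / 2))
     = x * Complex (b * cos \<theta>) (- (a * sin \<theta>))" for x \<theta> a b
  proof -
    have "(\<Sum>s\<in>{1, - 1}. cis (- (s * \<theta>)) * complex_of_real ((b + s * a) / 2))
      = Complex (b * cos \<theta>) (- (a * sin \<theta>))"
      by (simp add: complex_eq_iff) (simp add: field_simps)
    then show ?thesis by (simp only: mult.assoc flip: sum_distrib_left)
  qed
  show ?th1 unfolding U_AB_entries e proj by (rule trig[where b = 1, unfolded mult_1])
  show ?th2 unfolding U_AB_entries e proj by (rule trig[where b = 0, unfolded mult_zero_left add_0])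
qed

text \<open>Identifies \<open>c_coeff\<close> as the probability of staying in a basis state of that
  sector. For the ground state the second equation shows that the amplitude towards its junk partner
  vanishes.\<close>

lemma norm_U_AB:
  shows "(cmod (U_AB \<omega>A \<omega>B g t p p))\<^sup>2 = c_coeff \<omega>A \<omega>B g (lvl p) t"
    and "(cmod (U_AB \<omega>A \<omega>B g t p (ptn p)))\<^sup>2 = 1 - c_coeff \<omega>A \<omega>B g (lvl p) t"
proof -
  define R where "R = rabi \<omega>A \<omega>B g (lvl p) / 2"
  define k where "k = jc_detuning \<omega>A \<omega>B p"
  define c where "c = jc_coupling g p"
  have kc: "k\<^sup>2 + c\<^sup>2 = R\<^sup>2"
    using detuning_coupling_squares by (simp add: k_def c_def R_def)
  have e: "cmod (exp (- \<i> * t * jc_energy \<omega>A \<omega>B (lvl p))) = 1"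
    using norm_exp_i_times[of "- t * jc_energy \<omega>A \<omega>B (lvl p)"] by simp
  have "k\<^sup>2 = ((\<omega>A - \<omega>B) / 2)\<^sup>2" by (simp add: k_def jc_detuning_def)
  then have "k\<^sup>2 / R\<^sup>2 = (\<omega>A - \<omega>B)\<^sup>2 / (rabi \<omega>A \<omega>B g (lvl p))\<^sup>2"
    by (simp add: R_def power_divide)
  then have cc: "c_coeff \<omega>A \<omega>B g (lvl p) t = (cos (R * t))\<^sup>2 + k\<^sup>2 / R\<^sup>2 * (sin (R * t))\<^sup>2"
    by (simp add: c_coeff_def R_def)
  show "(cmod (U_AB \<omega>A \<omega>B g t p p))\<^sup>2 = c_coeff \<omega>A \<omega>B g (lvl p) t"
    unfolding U_AB_trig norm_mult e cc
    by (simp add: cmod_power2 k_def R_def power_mult_distrib power_divide)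
  have "(cmod (U_AB \<omega>A \<omega>B g t p (ptn p)))\<^sup>2 = c\<^sup>2 / R\<^sup>2 * (sin (R * t))\<^sup>2"
    unfolding U_AB_trig norm_mult e
    by (simp add: cmod_power2 c_def R_def power_mult_distrib power_divide)
  also have "\<dots> = 1 - c_coeff \<omega>A \<omega>B g (lvl p) t"
  proof (cases "R = 0")
    case True
    then show ?thesis by (simp add: cc)
  next
    case False
    then have cR: "c\<^sup>2 / R\<^sup>2 = 1 - k\<^sup>2 / R\<^sup>2"
      by (simp add: divide_simps) (simp add: kc[symmetric])
    show ?thesis unfolding cc cR cos_squared_eq by (simp add: left_diff_distrib)
  qed
  finally show "(cmod (U_AB \<omega>A \<omega>B g t p (ptn p)))\<^sup>2 = 1 - c_coeff \<omega>A \<omega>B g (lvl p) t" .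
qed

lemma rho_AB_entries:
  fixes \<omega>A \<omega>B \<beta>B g t :: real and \<rho>0 :: "complex^2^2"
  assumes "\<omega>B > 0" "\<beta>B > 0"
  defines "U \<equiv> U_AB \<omega>A \<omega>B g t"
    and "W \<equiv> \<rho>0 \<otimes> op_diag (\<lambda>n. of_real (thermal_weight \<omega>B \<beta>B n))"
  shows "rho_AB \<omega>A \<omega>B \<beta>B g \<rho>0 t p l =
     (U p p * W p l + U p (ptn p) * W (ptn p) l) * cnj (U l l)
   + (U p p * W p (ptn l) + U p (ptn p) * W (ptn p) (ptn l)) * cnj (U l (ptn l))"
proof -
  have UW: "(U \<odot> W) p r = U p p * W p r + U p (ptn p) * W (ptn p) r" for r
  proof -
    have "(U \<odot> W) p r = (\<Sum>k\<in>{p, ptn p}. U p k * W k r)"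
      by (intro op_mult_finite) (auto simp: U_def U_AB_support)
    then show ?thesis by simp
  qed
  have "(U \<odot> W \<odot> op_adj U) p l = (\<Sum>k\<in>{l, ptn l}. (U \<odot> W) p k * op_adj U k l)"
    by (intro op_mult_finite) (auto simp: U_def U_AB_support op_adj_def)
  then show ?thesis
    by (simp add: rho_AB_def thermal_diag[OF assms(1,2)] UW op_adj_def flip: U_def W_def)
qed

section \<open>Series and growth bounds\<close>

text \<open>The M-test turns the bound, uniform in time, into uniform convergence of the
  differentiated series.\<close>

lemma has_vector_derivative_suminf:
  fixes f :: "nat \<Rightarrow> real \<Rightarrow> 'a::banach"
  assumes der: "\<And>n s. (f n has_vector_derivative f' n s) (at s)"
    and bound: "\<And>n s. norm (f' n s) \<le> M n" and M: "summable M"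
    and summ: "summable (\<lambda>n. f n t)"
  shows "((\<lambda>s. \<Sum>n. f n s) has_vector_derivative (\<Sum>n. f' n t)) (at t)"
proof -
  have unif: "uniform_limit UNIV (\<lambda>n x. \<Sum>i<n. f' i x) (\<lambda>x. \<Sum>i. f' i x) sequentially"
    by (rule Weierstrass_m_test) (use bound M in auto)
  have "\<exists>g. \<forall>x\<in>UNIV. (\<lambda>n. f n x) sums (g x) \<and>
    (g has_derivative (\<lambda>h. h *\<^sub>R (\<Sum>i. f' i x))) (at x within UNIV)"
  proof (rule has_derivative_series[where f' = "\<lambda>n x h. h *\<^sub>R f' n x"])
    show "(f n has_derivative (\<lambda>h. h *\<^sub>R f' n x)) (at x within UNIV)" for n x
      using der by (simp add: has_vector_derivative_def)
    show "\<forall>\<^sub>F n in sequentially. \<forall>x\<in>UNIV. \<forall>h.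
      norm ((\<Sum>i<n. h *\<^sub>R f' i x) - h *\<^sub>R (\<Sum>i. f' i x)) \<le> e * norm h" if "e > 0" for e
      using uniform_limitD[OF unif that]
    proof eventually_elim
      case (elim n)
      show ?case
      proof (intro ballI allI)
        fix x h
        have "norm ((\<Sum>i<n. h *\<^sub>R f' i x) - h *\<^sub>R (\<Sum>i. f' i x))
          = \<bar>h\<bar> * norm ((\<Sum>i<n. f' i x) - (\<Sum>i. f' i x))"
          by (simp flip: scaleR_sum_right scaleR_diff_right)
        also have "\<dots> \<le> \<bar>h\<bar> * e"
          using elim by (intro mult_left_mono) (auto simp: dist_norm less_imp_le)
        finally show "norm ((\<Sum>i<n. h *\<^sub>R f' i x) - h *\<^sub>R (\<Sum>i. f' i x)) \<le> e * norm h"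
          by (simp add: mult.commute)
      qed
    qed
    show "(\<lambda>n. f n t) sums (\<Sum>n. f n t)" using summ by (rule summable_sums)
  qed auto
  then obtain g where g: "\<And>x. (\<lambda>n. f n x) sums (g x)"
    "\<And>x. (g has_derivative (\<lambda>h. h *\<^sub>R (\<Sum>i. f' i x))) (at x)" by auto
  have "g = (\<lambda>s. \<Sum>n. f n s)" using g(1) by (auto simp: sums_iff)
  then show ?thesis using g(2)[of t] by (simp add: has_vector_derivative_def)
qed

text \<open>The polynomial factor is the coefficient of the twice differentiated geometric series.
  It serves the energy: one linear factor comes from the rate of change, the other from the number
  operator.\<close>

lemma summable_geometric_quadratic:
  fixes q :: real
  assumes "0 \<le> q" "q < 1"
  shows "summable (\<lambda>n. (real n + 1) * (real n + 2) * q ^ n)"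
proof -
  have 1: "summable (\<lambda>n. diffs (\<lambda>_. 1) n * x ^ n)" if "norm x < 1" for x :: real
    by (rule termdiff_converges[OF that]) (auto intro: summable_geometric)
  have "summable (\<lambda>n. diffs (diffs (\<lambda>_. 1)) n * q ^ n)"
    by (rule termdiff_converges[where K = 1]) (use assms 1 in auto)
  then show ?thesis by (simp add: diffs_def algebra_simps)
qed

lemma infsum_nat_eq_suminf:
  fixes f :: "nat \<Rightarrow> 'a::banach"
  assumes "summable (\<lambda>n. norm (f n))"
  shows "infsum f UNIV = suminf f"
  by (rule infsumI[OF norm_summable_imp_has_sum[OF assms summable_sums[OF summable_norm_cancel[OF assms]]]])

text \<open>Summation by parts: \<open>D n\<close> occurs with weight n and, shifted by one, with
  weight - (n + 1), leaving - 1. Absolute summability of n * D n permits splitting the sum.\<close>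

lemma infsum_telescope_weighted:
  fixes D :: "nat \<Rightarrow> 'a::banach"
  assumes "summable (\<lambda>n. (real n + 1) * norm (D n))"
  shows "(\<Sum>\<^sub>\<infinity>n. real n *\<^sub>R (D n - (case n of 0 \<Rightarrow> 0 | Suc m \<Rightarrow> D m))) = - (\<Sum>n. D n)"
proof -
  let ?E = "\<lambda>n. real n *\<^sub>R D n" and ?F = "\<lambda>n. real n *\<^sub>R (case n of 0 \<Rightarrow> 0 | Suc m \<Rightarrow> D m)"
  have nD: "summable (\<lambda>n. norm (D n))"
    by (rule summable_comparison_test'[OF assms, of 0]) (simp add: algebra_simps)
  have nE: "summable (\<lambda>n. norm (?E n))"
    by (rule summable_comparison_test'[OF assms, of 0]) (simp add: algebra_simps)
  have nF: "summable (\<lambda>n. norm (?F n))"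
    by (subst summable_Suc_iff[symmetric]) (use assms in \<open>simp add: add.commute\<close>)
  have sE: "summable ?E" and sF: "summable ?F" and sD: "summable D"
    by (rule summable_norm_cancel[OF nE] summable_norm_cancel[OF nF] summable_norm_cancel[OF nD])+
  have "summable (\<lambda>n. norm (?E n - ?F n))"
    by (rule summable_comparison_test'[OF summable_add[OF nE nF], of 0])
      (simp only: real_norm_def abs_norm_cancel norm_triangle_ineq4)
  then have "(\<Sum>\<^sub>\<infinity>n. ?E n - ?F n) = (\<Sum>n. ?E n - ?F n)" by (rule infsum_nat_eq_suminf)
  also have "\<dots> = suminf ?E - suminf ?F" using sE sF by (rule suminf_diff[symmetric])
  also have "suminf ?F = (\<Sum>n. real (Suc n) *\<^sub>R D n)"
    using suminf_split_head[OF sF] by simp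
  also have "\<dots> = (\<Sum>n. D n + ?E n)" by (simp add: algebra_simps)
  also have "\<dots> = suminf D + suminf ?E" using sD sE by (rule suminf_add[symmetric])
  finally show ?thesis by (simp add: scaleR_diff_right)
qed

text \<open>The frequency grows at most like the square root of n; the linear bound keeps all
  majorants of the form polynomial times geometric.\<close>

lemma rabi_le: "rabi \<omega>A \<omega>B g n \<le> (\<bar>\<omega>A - \<omega>B\<bar> + 2 * \<bar>g\<bar>) * (real n + 1)"
proof -
  have "sqrt ((\<omega>A - \<omega>B)\<^sup>2 + 4 * g\<^sup>2 * real n) \<le> sqrt ((\<omega>A - \<omega>B)\<^sup>2) + sqrt (4 * g\<^sup>2 * real n)"
    by (intro sqrt_add_le_add_sqrt) auto
  also have "\<dots> = \<bar>\<omega>A - \<omega>B\<bar> + 2 * \<bar>g\<bar> * sqrt (real n)"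
    by (simp add: real_sqrt_mult)
  also have "\<dots> \<le> \<bar>\<omega>A - \<omega>B\<bar> * (real n + 1) + 2 * \<bar>g\<bar> * (real n + 1)"
  proof (intro add_mono mult_left_mono)
    show "\<bar>\<omega>A - \<omega>B\<bar> \<le> \<bar>\<omega>A - \<omega>B\<bar> * (real n + 1)" by (simp add: algebra_simps)
    have "real n \<le> (real n + 1)\<^sup>2" by (simp add: power2_eq_square algebra_simps)
    then show "sqrt (real n) \<le> real n + 1" by (intro real_le_lsqrt) auto
  qed auto
  finally show ?thesis by (simp add: rabi_def algebra_simps)
qed

lemma rabi_nonneg: "rabi \<omega>A \<omega>B g n \<ge> 0"
  by (simp add: rabi_def)

lemma c_coeff_0: "c_coeff \<omega>A \<omega>B g 0 t = 1"
  by (cases "\<omega>A = \<omega>B") (simp_all add: c_coeff_def rabi_def)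

lemma c_coeff_nonneg: "0 \<le> c_coeff \<omega>A \<omega>B g n t"
  and c_coeff_le_1: "c_coeff \<omega>A \<omega>B g n t \<le> 1"
proof -
  show "0 \<le> c_coeff \<omega>A \<omega>B g n t"
    using norm_U_AB(1)[of \<omega>A \<omega>B g t "(0, n)", symmetric] by simp
  have "0 \<le> 1 - c_coeff \<omega>A \<omega>B g n t"
    using norm_U_AB(2)[of \<omega>A \<omega>B g t "(0, n)", symmetric] by simp
  then show "c_coeff \<omega>A \<omega>B g n t \<le> 1" by simp
qed

definition c_deriv :: "real \<Rightarrow> real \<Rightarrow> real \<Rightarrow> nat \<Rightarrow> real \<Rightarrow> real" where
  "c_deriv \<omega>A \<omega>B g n t =
     ((\<omega>A - \<omega>B)\<^sup>2 / (rabi \<omega>A \<omega>B g n)\<^sup>2 - 1) * (rabi \<omega>A \<omega>B g n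
       * (sin (rabi \<omega>A \<omega>B g n * t / 2) * cos (rabi \<omega>A \<omega>B g n * t / 2)))"

lemma c_coeff_deriv: "(c_coeff \<omega>A \<omega>B g n has_real_derivative c_deriv \<omega>A \<omega>B g n t) (at t)"
proof -
  have "((\<lambda>t. (cos (k * t / 2))\<^sup>2 + a * (sin (k * t / 2))\<^sup>2) has_real_derivative
    (a - 1) * (k * (sin (k * t / 2) * cos (k * t / 2)))) (at t)" for a k :: real
    by (auto intro!: derivative_eq_intros simp: algebra_simps)
  then show ?thesis unfolding c_coeff_def[abs_def] c_deriv_def .
qed

lemma c_deriv_le: "\<bar>c_deriv \<omega>A \<omega>B g n t\<bar> \<le> (\<bar>\<omega>A - \<omega>B\<bar> + 2 * \<bar>g\<bar>) * (real n + 1)"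
proof -
  define a where "a = (\<omega>A - \<omega>B)\<^sup>2 / (rabi \<omega>A \<omega>B g n)\<^sup>2"
  let ?x = "rabi \<omega>A \<omega>B g n * t / 2"
  have "(\<omega>A - \<omega>B)\<^sup>2 \<le> (rabi \<omega>A \<omega>B g n)\<^sup>2" by (simp add: rabi_def)
  then have "0 \<le> a" "a \<le> 1" by (auto simp: a_def divide_le_eq_1)
  then have "\<bar>a - 1\<bar> \<le> 1" by simp
  moreover have "\<bar>sin ?x * cos ?x\<bar> \<le> 1 * 1"
    unfolding abs_mult by (intro mult_mono) auto
  ultimately have "\<bar>a - 1\<bar> * (rabi \<omega>A \<omega>B g n * \<bar>sin ?x * cos ?x\<bar>) \<le> 1 * (rabi \<omega>A \<omega>B g n * 1)"
    by (intro mult_mono) (auto simp: rabi_nonneg intro: mult_left_le)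
  then have "\<bar>c_deriv \<omega>A \<omega>B g n t\<bar> \<le> rabi \<omega>A \<omega>B g n"
    by (simp add: c_deriv_def abs_mult rabi_nonneg flip: a_def)
  then show ?thesis using rabi_le order_trans by blast
qed

lemma norm_U_AB_le_1: "cmod (U_AB \<omega>A \<omega>B g t p p) \<le> 1"
  using c_coeff_le_1[of \<omega>A \<omega>B g "lvl p" t] by (simp add: abs_square_le_1 flip: norm_U_AB(1))

text \<open>Diagonal entries suffice for the coherences of the reduced state, see
  \<open>rho_AB_coherence\<close>. In this phase form the derivative is bounded by the energy
  levels.\<close>

definition U_deriv :: "real \<Rightarrow> real \<Rightarrow> real \<Rightarrow> 2 \<times> nat \<Rightarrow> real \<Rightarrow> complex" where
  "U_deriv \<omega>A \<omega>B g p t = (\<Sum>s\<in>{1, - 1}. (- \<i> * jc_level \<omega>A \<omega>B g s (lvl p)) *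
     exp (- \<i> * t * jc_level \<omega>A \<omega>B g s (lvl p)) * jc_proj \<omega>A \<omega>B g s p p)"

lemma U_AB_deriv:
  "((\<lambda>t. U_AB \<omega>A \<omega>B g t p p) has_vector_derivative U_deriv \<omega>A \<omega>B g p t) (at t)"
proof -
  have e: "((\<lambda>t. exp (- \<i> * complex_of_real t * a) * b) has_vector_derivative
    (- \<i> * a) * exp (- \<i> * complex_of_real t * a) * b) (at t)" for a b
  proof -
    have "((\<lambda>z. exp (- \<i> * z * a) * b) has_field_derivative
      (- \<i> * a) * exp (- \<i> * complex_of_real t * a) * b) (at (of_real t))"
      by (auto intro!: derivative_eq_intros)
    then show ?thesis by (rule has_vector_derivative_real_field)
  qed
  show ?thesis
    unfolding U_AB_entries U_deriv_def by (intro has_vector_derivative_sum e)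
qed

lemma U_deriv_le:
  "cmod (U_deriv \<omega>A \<omega>B g p t) \<le> 2 * (\<bar>\<omega>B\<bar> + \<bar>\<omega>A - \<omega>B\<bar> + 2 * \<bar>g\<bar>) * (real (lvl p) + 1)"
proof -
  define R where "R = rabi \<omega>A \<omega>B g (lvl p)"
  define C where "C = (\<bar>\<omega>B\<bar> + \<bar>\<omega>A - \<omega>B\<bar> + 2 * \<bar>g\<bar>) * (real (lvl p) + 1)"
  have R2: "R\<^sup>2 = (\<omega>A - \<omega>B)\<^sup>2 + 4 * g\<^sup>2 * real (lvl p)" by (simp add: R_def rabi_def)
  have R0: "R \<ge> 0" by (simp add: R_def rabi_nonneg)
  have "\<bar>\<omega>A - \<omega>B\<bar> \<le> R"
    by (rule power2_le_imp_le) (use R2 R0 in auto)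
  then have "\<bar>jc_detuning \<omega>A \<omega>B p\<bar> \<le> R / 2" by (simp add: jc_detuning_def)
  then have r: "\<bar>jc_detuning \<omega>A \<omega>B p / (R / 2)\<bar> \<le> 1"
    using R0 by (auto simp: divide_le_eq_1)
  have P: "\<bar>jc_proj \<omega>A \<omega>B g s p p\<bar> \<le> 1" if "s \<in> {1, - 1}" for s
  proof -
    define x where "x = jc_detuning \<omega>A \<omega>B p / (R / 2)"
    have "jc_proj \<omega>A \<omega>B g s p p = (1 + s * x) / 2"
      by (simp add: jc_proj_def jc_mix_def R_def x_def)
    moreover have "\<bar>x\<bar> \<le> 1" using r by (simp add: x_def)
    ultimately show ?thesis using that by auto
  qed
  have L: "\<bar>jc_level \<omega>A \<omega>B g s (lvl p)\<bar> \<le> C" if "s \<in> {1, - 1}" for s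
  proof -
    have "\<bar>jc_level \<omega>A \<omega>B g s (lvl p)\<bar> \<le> \<bar>\<omega>B * real (lvl p)\<bar> + \<bar>\<omega>A - \<omega>B\<bar> / 2 + R / 2"
    proof -
      have "\<bar>s\<bar> = 1" using that by auto
      then have "\<bar>\<omega>A - \<omega>B\<bar> / 2 = \<bar>(\<omega>A - \<omega>B) / 2\<bar>" "R / 2 = \<bar>s * (R / 2)\<bar>"
        using R0 by (simp_all add: abs_mult)
      then show ?thesis
        unfolding jc_level_def jc_energy_def R_def[symmetric]
        by (simp only: order_trans[OF abs_triangle_ineq add_right_mono[OF abs_triangle_ineq]])
    qed
    also have "\<dots> \<le> \<bar>\<omega>B * real (lvl p)\<bar> + R" using \<open>\<bar>\<omega>A - \<omega>B\<bar> \<le> R\<close> by simp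
    also have "\<dots> \<le> \<bar>\<omega>B\<bar> * (real (lvl p) + 1) + (\<bar>\<omega>A - \<omega>B\<bar> + 2 * \<bar>g\<bar>) * (real (lvl p) + 1)"
      unfolding R_def by (intro add_mono rabi_le) (simp add: abs_mult algebra_simps)
    finally show ?thesis by (simp add: C_def algebra_simps)
  qed
  have C0: "C \<ge> 0" by (simp add: C_def)
  have "cmod (U_deriv \<omega>A \<omega>B g p t) \<le> (\<Sum>s\<in>{1, - 1::real}. C)"
    unfolding U_deriv_def
  proof (intro sum_norm_le)
    fix s :: real
    assume s: "s \<in> {1, - 1}"
    have e: "cmod (exp (- \<i> * t * jc_level \<omega>A \<omega>B g s (lvl p))) = 1"
      using norm_exp_i_times[of "- t * jc_level \<omega>A \<omega>B g s (lvl p)"] by simp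
    show "cmod ((- \<i> * jc_level \<omega>A \<omega>B g s (lvl p)) *
     exp (- \<i> * t * jc_level \<omega>A \<omega>B g s (lvl p)) * jc_proj \<omega>A \<omega>B g s p p) \<le> C"
      unfolding norm_mult e using mult_mono[OF L[OF s] P[OF s]] C0 by simp
  qed
  then show ?thesis by (simp add: C_def algebra_simps)
qed

section \<open>Populations, coherence and the fixed point\<close>

context
  fixes \<omega>A \<omega>B \<beta>B g :: real and \<rho>0 :: "complex^2^2"
  assumes \<omega>B: "\<omega>B > 0" and \<beta>B: "\<beta>B > 0" and dens: "density_matrix \<rho>0"
begin

private abbreviation (input) w :: "nat \<Rightarrow> real" where "w \<equiv> thermal_weight \<omega>B \<beta>B"
private abbreviation (input) q :: real where "q \<equiv> exp (- \<beta>B * \<omega>B)"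
private abbreviation (input) c :: "nat \<Rightarrow> real \<Rightarrow> real" where "c \<equiv> c_coeff \<omega>A \<omega>B g"
private abbreviation (input) U where "U \<equiv> U_AB \<omega>A \<omega>B g"
private abbreviation (input) RAB where "RAB \<equiv> rho_AB \<omega>A \<omega>B \<beta>B g \<rho>0"
private abbreviation (input) RA where "RA \<equiv> rho_A \<omega>A \<omega>B \<beta>B g \<rho>0"

section \<open>Thermal weights and their moments\<close>

lemma w_nonneg: "w n \<ge> 0"
  using \<omega>B \<beta>B by (simp add: thermal_weight_geometric)

lemma summable_w2: "summable (\<lambda>n. (real n + 1) * (real n + 2) * w n)"
proof -
  have "summable (\<lambda>n. (1 - q) * ((real n + 1) * (real n + 2) * q ^ n))"
    using \<omega>B \<beta>B by (intro summable_mult summable_geometric_quadratic) auto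
  then show ?thesis by (simp add: thermal_weight_geometric mult_ac)
qed

lemma summable_w1: "summable (\<lambda>n. (real n + 2) * w n)"
proof (rule summable_comparison_test'[OF summable_w2, of 0])
  fix n
  have "1 * (real n + 2) * w n \<le> (real n + 1) * (real n + 2) * w n"
    by (intro mult_right_mono w_nonneg) simp_all
  then show "norm ((real n + 2) * w n) \<le> (real n + 1) * (real n + 2) * w n"
    by (simp add: abs_mult w_nonneg)
qed

lemma rho0_entries:
  "\<rho>0 $ 1 $ 0 = cnj (\<rho>0 $ 0 $ 1)" "cnj (\<rho>0 $ 0 $ 0) = \<rho>0 $ 0 $ 0" "cnj (\<rho>0 $ 1 $ 1) = \<rho>0 $ 1 $ 1"
  "\<rho>0 $ 0 $ 0 + \<rho>0 $ 1 $ 1 = 1"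
proof -
  have h: "cadj \<rho>0 = \<rho>0" and tr: "trace \<rho>0 = 1" using dens by (auto simp: density_matrix_def)
  show "\<rho>0 $ 1 $ 0 = cnj (\<rho>0 $ 0 $ 1)" using hermitian_entries[OF h] by blast
  show "cnj (\<rho>0 $ 0 $ 0) = \<rho>0 $ 0 $ 0" "cnj (\<rho>0 $ 1 $ 1) = \<rho>0 $ 1 $ 1"
    using hermitian_entries(2,3)[OF h] by (metis complex_cnj_complex_of_real)+
  show "\<rho>0 $ 0 $ 0 + \<rho>0 $ 1 $ 1 = 1" using tr by (simp add: trace_2_01)
qed

section \<open>Matrix elements of the evolved composite state\<close>

lemma mult_cnj_norm: "z * x * cnj z = of_real ((cmod z)\<^sup>2) * x"
  using complex_norm_square[of z] by (simp add: mult_ac)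

text \<open>The state (1, n) is fed by itself with weight \<open>w n\<close> and by (0, Suc n) with
  weight \<open>w (Suc n) = q * w n\<close>; interference terms vanish because the thermal state is
  diagonal.\<close>

lemma rho_AB_upper:
  "RAB t (1, n) (1, n) = of_real (w n) *
    (\<rho>0 $ 1 $ 1 * of_real (c (Suc n) t) + of_real q * \<rho>0 $ 0 $ 0 * of_real (1 - c (Suc n) t))"
  unfolding rho_AB_entries[OF \<omega>B \<beta>B]
  by (simp add: tens_def op_diag_def mult_cnj_norm norm_U_AB[where p = "(1, n)", simplified]
      thermal_weight_Suc) (simp add: algebra_simps)

lemma rho_AB_lower_0: "RAB t (0, 0) (0, 0) = of_real (w 0) * \<rho>0 $ 0 $ 0"
  unfolding rho_AB_entries[OF \<omega>B \<beta>B]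
  using norm_U_AB[where p = "(0, 0)", of \<omega>A \<omega>B g t]
  by (simp add: tens_def op_diag_def mult_cnj_norm c_coeff_0)

lemma rho_AB_lower_Suc:
  "RAB t (0, Suc n) (0, Suc n) = of_real (w n) *
    (of_real q * \<rho>0 $ 0 $ 0 * of_real (c (Suc n) t) + \<rho>0 $ 1 $ 1 * of_real (1 - c (Suc n) t))"
  unfolding rho_AB_entries[OF \<omega>B \<beta>B]
  by (simp add: tens_def op_diag_def mult_cnj_norm norm_U_AB[where p = "(0, Suc n)", simplified]
      thermal_weight_Suc) (simp add: algebra_simps)

lemma rho_AB_coherence:
  "RAB t (1, n) (0, n) = of_real (w n) * \<rho>0 $ 1 $ 0 * (U t (1, n) (1, n) * cnj (U t (0, n) (0, n)))"
  "RAB t (0, n) (1, n) = of_real (w n) * \<rho>0 $ 0 $ 1 * (U t (0, n) (0, n) * cnj (U t (1, n) (1, n)))"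
proof -
  \<comment> \<open>The junk partner (1, 0) of the ground state shares its Fock number 0, so for
    \<open>n = 0\<close> one unwanted term is removed by this amplitude and not by the diagonal
    thermal state.\<close>
  have 0: "U t (0, 0) (1, 0) = 0"
    using norm_U_AB(2)[where p = "(0, 0)", of \<omega>A \<omega>B g t] by (simp add: c_coeff_0)
  show "RAB t (1, n) (0, n) = of_real (w n) * \<rho>0 $ 1 $ 0 * (U t (1, n) (1, n) * cnj (U t (0, n) (0, n)))"
  "RAB t (0, n) (1, n) = of_real (w n) * \<rho>0 $ 0 $ 1 * (U t (0, n) (0, n) * cnj (U t (1, n) (1, n)))"
    unfolding rho_AB_entries[OF \<omega>B \<beta>B]
    by (cases n; simp add: tens_def op_diag_def 0)+
qed

text \<open>The probability current from (0, Suc n) to (1, n). It vanishes when the initial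
  populations have the ratio \<open>q\<close>.\<close>

definition transfer_rate :: "nat \<Rightarrow> real \<Rightarrow> complex" where
  "transfer_rate n s = of_real (w n * c_deriv \<omega>A \<omega>B g (Suc n) s) * (\<rho>0 $ 1 $ 1 - of_real q * \<rho>0 $ 0 $ 0)"

lemma c_coeff_cderiv:
  "((\<lambda>s. complex_of_real (c n s)) has_vector_derivative of_real (c_deriv \<omega>A \<omega>B g n s)) (at s)"
  using c_coeff_deriv[of \<omega>A \<omega>B g n s] unfolding has_real_derivative_iff_has_vector_derivative
  by (rule bounded_linear.has_vector_derivative[OF bounded_linear_of_real])

lemma rho_AB_upper_deriv: "((\<lambda>s. RAB s (1, n) (1, n)) has_vector_derivative transfer_rate n s) (at s)"
proof -
  have "RAB s (1, n) (1, n) = of_real (w n) * (\<rho>0 $ 1 $ 1 - of_real q * \<rho>0 $ 0 $ 0) * of_real (c (Suc n) s)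
     + of_real (w n) * of_real q * \<rho>0 $ 0 $ 0" for s
    unfolding rho_AB_upper by (simp add: algebra_simps)
  moreover have "((\<lambda>s. of_real (w n) * (\<rho>0 $ 1 $ 1 - of_real q * \<rho>0 $ 0 $ 0) * of_real (c (Suc n) s)
     + of_real (w n) * of_real q * \<rho>0 $ 0 $ 0) has_vector_derivative
      of_real (w n) * (\<rho>0 $ 1 $ 1 - of_real q * \<rho>0 $ 0 $ 0) * of_real (c_deriv \<omega>A \<omega>B g (Suc n) s) + 0) (at s)"
    by (intro has_vector_derivative_add has_vector_derivative_mult_right has_vector_derivative_const c_coeff_cderiv)
  ultimately show ?thesis by (simp add: transfer_rate_def mult_ac)
qed

lemma rho_AB_lower_deriv:
  "((\<lambda>s. RAB s (0, n) (0, n)) has_vector_derivative (case n of 0 \<Rightarrow> 0 | Suc m \<Rightarrow> - transfer_rate m s)) (at s)"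
proof (cases n)
  case 0
  then show ?thesis by (simp add: rho_AB_lower_0)
next
  case (Suc m)
  \<comment> \<open>The total population of a sector is constant, so the current into one state
    leaves the other.\<close>
  have "RAB s (0, Suc m) (0, Suc m) = of_real (w m) * (\<rho>0 $ 1 $ 1 + of_real q * \<rho>0 $ 0 $ 0)
     - RAB s (1, m) (1, m)" for s
    unfolding rho_AB_upper rho_AB_lower_Suc by (simp add: algebra_simps)
  moreover have "((\<lambda>s. of_real (w m) * (\<rho>0 $ 1 $ 1 + of_real q * \<rho>0 $ 0 $ 0)
     - RAB s (1, m) (1, m)) has_vector_derivative 0 - transfer_rate m s) (at s)"
    by (intro has_vector_derivative_diff has_vector_derivative_const rho_AB_upper_deriv)
  ultimately show ?thesis by (simp add: Suc)
qed

text \<open>The factor n + 2 is the linear bound on \<open>c_deriv\<close> at index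
  \<open>Suc n\<close>; the constant is independent of time, as the M-test demands.\<close>

lemma transfer_rate_le: "\<exists>C. \<forall>n s. norm (transfer_rate n s) \<le> C * ((real n + 2) * w n)"
proof (intro exI allI)
  fix n s
  have "\<bar>w n * c_deriv \<omega>A \<omega>B g (Suc n) s\<bar> \<le> w n * ((\<bar>\<omega>A - \<omega>B\<bar> + 2 * \<bar>g\<bar>) * (real (Suc n) + 1))"
    unfolding abs_mult by (intro mult_mono c_deriv_le) (auto simp: w_nonneg)
  then have "norm (transfer_rate n s) \<le> w n * ((\<bar>\<omega>A - \<omega>B\<bar> + 2 * \<bar>g\<bar>) * (real (Suc n) + 1)) * cmod (\<rho>0 $ 1 $ 1 - of_real q * \<rho>0 $ 0 $ 0)"
    unfolding transfer_rate_def norm_mult norm_of_real by (rule mult_right_mono) simp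
  then show "norm (transfer_rate n s) \<le> (\<bar>\<omega>A - \<omega>B\<bar> + 2 * \<bar>g\<bar>) * cmod (\<rho>0 $ 1 $ 1 - of_real q * \<rho>0 $ 0 $ 0) * ((real n + 2) * w n)"
    by (simp add: mult_ac add_ac)
qed

lemma summable_transfer_rate: "summable (\<lambda>n. (real n + 1) * norm (transfer_rate n s))"
proof -
  obtain C where C: "\<And>n. norm (transfer_rate n s) \<le> C * ((real n + 2) * w n)"
    using transfer_rate_le by blast
  have "(real n + 1) * norm (transfer_rate n s) \<le> C * ((real n + 1) * (real n + 2) * w n)" for n
    using mult_left_mono[OF C[of n], of "real n + 1"] by (simp add: mult_ac)
  then show ?thesis
    by (intro summable_comparison_test'[OF summable_mult[OF summable_w2, of C], of 0]) (simp add: abs_mult)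
qed

text \<open>Fock level m gains the current into (1, m) and loses the one from (0, m) into (1, m -
  1). Weighting by m and summing by parts leaves minus the total current.\<close>

lemma dE_B_eq: "dE_B \<omega>A \<omega>B \<beta>B g \<rho>0 t = - of_real \<omega>B * (\<Sum>n. transfer_rate n t)"
proof -
  have der: "op_deriv (rho_B \<omega>A \<omega>B \<beta>B g \<rho>0) t m m = transfer_rate m t - (case m of 0 \<Rightarrow> 0 | Suc k \<Rightarrow> transfer_rate k t)" for m
  proof -
    have "((\<lambda>s. rho_B \<omega>A \<omega>B \<beta>B g \<rho>0 s m m) has_vector_derivative
       (case m of 0 \<Rightarrow> 0 | Suc k \<Rightarrow> - transfer_rate k t) + transfer_rate m t) (at t)"
      unfolding rho_B_def sum_2_01
      by (intro has_vector_derivative_add rho_AB_lower_deriv rho_AB_upper_deriv)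
    then show ?thesis unfolding op_deriv_def
      by (subst vector_derivative_at) (auto split: nat.splits)
  qed
  have "dE_B \<omega>A \<omega>B \<beta>B g \<rho>0 t =
    (\<Sum>\<^sub>\<infinity>m. of_real \<omega>B * (real m *\<^sub>R (transfer_rate m t - (case m of 0 \<Rightarrow> 0 | Suc k \<Rightarrow> transfer_rate k t))))"
    unfolding dE_B_def op_trace_def H_B_diag op_diag_mult der
    by (simp add: scaleR_conv_of_real mult_ac)
  also have "\<dots> = of_real \<omega>B * (\<Sum>\<^sub>\<infinity>m. real m *\<^sub>R (transfer_rate m t - (case m of 0 \<Rightarrow> 0 | Suc k \<Rightarrow> transfer_rate k t)))"
    by (rule infsum_cmult_right')
  also have "\<dots> = of_real \<omega>B * (- (\<Sum>n. transfer_rate n t))"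
    by (subst infsum_telescope_weighted[OF summable_transfer_rate]) simp
  finally show ?thesis by simp
qed

section \<open>The reduced state: convergence, trace and Hermiticity\<close>

lemma rho_AB_diag_le:
  "norm (RAB s (1, n) (1, n)) \<le> (cmod (\<rho>0 $ 1 $ 1) + q * cmod (\<rho>0 $ 0 $ 0)) * w n"
  "norm (RAB s (0, Suc n) (0, Suc n)) \<le> (cmod (\<rho>0 $ 1 $ 1) + q * cmod (\<rho>0 $ 0 $ 0)) * w n"
proof -
  have c: "\<bar>c (Suc n) s\<bar> \<le> 1" "\<bar>1 - c (Suc n) s\<bar> \<le> 1"
    using c_coeff_nonneg[of \<omega>A \<omega>B g "Suc n" s] c_coeff_le_1[of \<omega>A \<omega>B g "Suc n" s] by auto
  have *: "norm (of_real (w n) * (a * of_real x + b * of_real y)) \<le> (cmod a + cmod b) * w n"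
    if "\<bar>x\<bar> \<le> 1" "\<bar>y\<bar> \<le> 1" for a b x y
  proof -
    have "norm (a * of_real x + b * of_real y) \<le> cmod a * \<bar>x\<bar> + cmod b * \<bar>y\<bar>"
      by (rule order_trans[OF norm_triangle_ineq]) (simp add: norm_mult)
    also have "\<dots> \<le> cmod a * 1 + cmod b * 1"
      by (intro add_mono mult_left_mono that) auto
    finally show ?thesis
      by (simp add: norm_mult w_nonneg mult.commute mult_left_mono)
  qed
  show "norm (RAB s (1, n) (1, n)) \<le> (cmod (\<rho>0 $ 1 $ 1) + q * cmod (\<rho>0 $ 0 $ 0)) * w n"
    unfolding rho_AB_upper using *[OF c, of "\<rho>0 $ 1 $ 1" "of_real q * \<rho>0 $ 0 $ 0"]
    by (simp add: norm_mult)
  show "norm (RAB s (0, Suc n) (0, Suc n)) \<le> (cmod (\<rho>0 $ 1 $ 1) + q * cmod (\<rho>0 $ 0 $ 0)) * w n"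
    unfolding rho_AB_lower_Suc using *[OF c, of "of_real q * \<rho>0 $ 0 $ 0" "\<rho>0 $ 1 $ 1"]
    by (simp add: norm_mult add.commute)
qed

lemma summable_w: "summable w"
  using thermal_weight_sums[OF \<omega>B \<beta>B] by (rule sums_summable)

text \<open>The partial trace is an \<open>infsum\<close>; absolute summability turns it into a
  \<open>suminf\<close>, which can be differentiated termwise.\<close>

lemma summable_rho_AB_diag: "summable (\<lambda>n. norm (RAB s (i, n) (i, n)))"
proof (cases i rule: two_cases)
  case 1
  have "summable (\<lambda>n. norm (RAB s (0, Suc n) (0, Suc n)))"
    by (rule summable_comparison_test'[OF summable_mult[OF summable_w], of 0])
      (use rho_AB_diag_le(2) in \<open>simp, blast\<close>)
  then show ?thesis unfolding 1 by (subst (asm) summable_Suc_iff)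
next
  case 2
  show ?thesis unfolding 2
    by (rule summable_comparison_test'[OF summable_mult[OF summable_w], of 0])
      (use rho_AB_diag_le(1) in \<open>simp, blast\<close>)
qed

lemma rho_A_diag: "RA s $ i $ i = (\<Sum>n. RAB s (i, n) (i, n))"
  by (simp add: rho_A_def infsum_nat_eq_suminf summable_rho_AB_diag)

lemma trace_rho_A: "trace (RA s) = 1"
proof -
  have sm: "summable (\<lambda>n. RAB s (i, n) (i, n))" for i
    using summable_rho_AB_diag by (rule summable_norm_cancel)
  have w: "(\<lambda>n. complex_of_real (w n)) sums 1"
    using sums_of_real[OF thermal_weight_sums[OF \<omega>B \<beta>B]] by simp
  have wS: "(\<lambda>n. complex_of_real (w (Suc n))) sums (1 - of_real (w 0))"
    using sums_Suc_iff[of "\<lambda>n. complex_of_real (w n)" "1 - of_real (w 0)"] w by simp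
  \<comment> \<open>The ground state is split off so that (0, Suc n) pairs with (1, n), the two
    states of one sector; the transferred amounts then cancel.\<close>
  have "trace (RA s) = (RAB s (0, 0) (0, 0) + (\<Sum>n. RAB s (0, Suc n) (0, Suc n))) + (\<Sum>n. RAB s (1, n) (1, n))"
    unfolding trace_2_01 rho_A_diag using suminf_split_head[OF sm[of 0]] by simp
  also have "\<dots> = RAB s (0, 0) (0, 0) + (\<Sum>n. RAB s (0, Suc n) (0, Suc n) + RAB s (1, n) (1, n))"
    using suminf_add[OF _ sm[of 1], of "\<lambda>n. RAB s (0, Suc n) (0, Suc n)"] sm[of 0]
    by (simp add: summable_Suc_iff[of "\<lambda>n. RAB s (0, n) (0, n)"])
  also have "(\<lambda>n. RAB s (0, Suc n) (0, Suc n) + RAB s (1, n) (1, n))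
     = (\<lambda>n. \<rho>0 $ 1 $ 1 * of_real (w n) + \<rho>0 $ 0 $ 0 * of_real (w (Suc n)))"
    unfolding rho_AB_lower_Suc rho_AB_upper thermal_weight_Suc by (simp add: fun_eq_iff algebra_simps)
  also have "(\<Sum>n. \<rho>0 $ 1 $ 1 * of_real (w n) + \<rho>0 $ 0 $ 0 * of_real (w (Suc n)))
     = \<rho>0 $ 1 $ 1 * 1 + \<rho>0 $ 0 $ 0 * (1 - of_real (w 0))"
    by (intro sums_unique[symmetric] sums_add sums_mult w wS)
  finally show ?thesis using rho0_entries(4) by (simp add: rho_AB_lower_0 algebra_simps)
qed

lemma cadj_rho_A: "cadj (RA s) = RA s"
proof -
  have "cnj (RAB s (i, n) (j, n)) = RAB s (j, n) (i, n)" for i j n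
    by (cases i rule: two_cases; cases j rule: two_cases; cases n)
      (simp_all add: rho_AB_upper rho_AB_lower_0 rho_AB_lower_Suc rho_AB_coherence rho0_entries)
  then show ?thesis by (simp add: cadj_def rho_A_def flip: infsum_cnj)
qed

section \<open>Differentiability of the reduced state\<close>

lemma rho_A_upper_deriv: "((\<lambda>s. RA s $ 1 $ 1) has_vector_derivative (\<Sum>n. transfer_rate n t)) (at t)"
proof -
  obtain C where C: "\<And>n s. norm (transfer_rate n s) \<le> C * ((real n + 2) * w n)" using transfer_rate_le by blast
  show ?thesis unfolding rho_A_diag
    by (intro has_vector_derivative_suminf[OF rho_AB_upper_deriv C] summable_mult summable_w1
        summable_norm_cancel[OF summable_rho_AB_diag])
qed

text \<open>The matrix derivative is meaningful only if the coherences are differentiable too. Bare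
  existence is enough: the logarithm of the fixed point is diagonal, so this derivative enters both
  rates through the same term.\<close>

lemma rho_A_coherence_deriv: "\<exists>d. ((\<lambda>s. RA s $ 1 $ 0) has_vector_derivative d) (at t)"
proof -
  let ?u = "\<lambda>n s. U s (1, n) (1, n)" and ?v = "\<lambda>n s. U s (0, n) (0, n)"
  let ?u' = "\<lambda>n s. U_deriv \<omega>A \<omega>B g (1, n) s" and ?v' = "\<lambda>n s. U_deriv \<omega>A \<omega>B g (0, n) s"
  let ?d = "\<lambda>n s. of_real (w n) * \<rho>0 $ 1 $ 0 * (?u n s * cnj (?v' n s) + ?u' n s * cnj (?v n s))"
  define K where "K = 2 * (\<bar>\<omega>B\<bar> + \<bar>\<omega>A - \<omega>B\<bar> + 2 * \<bar>g\<bar>)"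
  have K0: "K \<ge> 0" by (simp add: K_def)
  have d: "((\<lambda>s. RAB s (1, n) (0, n)) has_vector_derivative ?d n s) (at s)" for n s
    unfolding rho_AB_coherence
    by (intro has_vector_derivative_mult_right has_vector_derivative_mult U_AB_deriv
        bounded_linear.has_vector_derivative[OF bounded_linear_cnj])
  have bd: "norm (?d n s) \<le> (2 * K * cmod (\<rho>0 $ 1 $ 0)) * ((real n + 2) * w n)" for n s
  proof -
    have u: "cmod (?u' n s) \<le> K * (real n + 2)" "cmod (?v' n s) \<le> K * (real n + 2)"
    proof -
      show "cmod (?u' n s) \<le> K * (real n + 2)"
        using U_deriv_le[of \<omega>A \<omega>B g "(1, n)" s] by (simp add: K_def add_ac)
      have "cmod (?v' n s) \<le> K * (real n + 1)"
        using U_deriv_le[of \<omega>A \<omega>B g "(0, n)" s] by (simp add: K_def)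
      also have "\<dots> \<le> K * (real n + 2)" using K0 by (intro mult_left_mono) auto
      finally show "cmod (?v' n s) \<le> K * (real n + 2)" .
    qed
    have "cmod (?u n s * cnj (?v' n s) + ?u' n s * cnj (?v n s))
      \<le> cmod (?u n s) * cmod (?v' n s) + cmod (?u' n s) * cmod (?v n s)"
      by (rule order_trans[OF norm_triangle_ineq]) (simp add: norm_mult)
    also have "\<dots> \<le> 1 * (K * (real n + 2)) + K * (real n + 2) * 1"
      using K0 by (intro add_mono mult_mono u norm_U_AB_le_1) auto
    finally have "cmod (of_real (w n) * \<rho>0 $ 1 $ 0) * cmod (?u n s * cnj (?v' n s) + ?u' n s * cnj (?v n s))
      \<le> cmod (of_real (w n) * \<rho>0 $ 1 $ 0) * (2 * K * (real n + 2))"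
      by (intro mult_left_mono) auto
    also have "\<dots> = (2 * K * cmod (\<rho>0 $ 1 $ 0)) * ((real n + 2) * w n)"
      by (simp add: norm_mult w_nonneg)
    finally show ?thesis unfolding norm_mult[of "of_real (w n) * \<rho>0 $ 1 $ 0"] .
  qed
  have nb: "norm (RAB s (1, n) (0, n)) \<le> cmod (\<rho>0 $ 1 $ 0) * w n" for n s
  proof -
    have "cmod (?u n s * cnj (?v n s)) \<le> 1 * 1"
      unfolding norm_mult complex_mod_cnj by (intro mult_mono norm_U_AB_le_1) auto
    then have "cmod (of_real (w n) * \<rho>0 $ 1 $ 0) * cmod (?u n s * cnj (?v n s)) \<le> cmod (of_real (w n) * \<rho>0 $ 1 $ 0) * 1"
      by (intro mult_left_mono) auto
    then show ?thesis unfolding rho_AB_coherence norm_mult[of "of_real (w n) * \<rho>0 $ 1 $ 0"]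
      by (simp add: norm_mult w_nonneg mult_ac)
  qed
  have sm: "summable (\<lambda>n. norm (RAB s (1, n) (0, n)))" for s
    by (rule summable_comparison_test'[OF summable_mult[OF summable_w], of 0]) (use nb in \<open>simp, blast\<close>)
  have M: "summable (\<lambda>n. (2 * K * cmod (\<rho>0 $ 1 $ 0)) * ((real n + 2) * w n))"
    by (intro summable_mult summable_w1)
  have "((\<lambda>s. \<Sum>n. RAB s (1, n) (0, n)) has_vector_derivative (\<Sum>n. ?d n t)) (at t)"
    by (rule has_vector_derivative_suminf[OF d bd M summable_norm_cancel[OF sm]])
  moreover have "RA s $ 1 $ 0 = (\<Sum>n. RAB s (1, n) (0, n))" for s
    by (simp add: rho_A_def infsum_nat_eq_suminf sm)
  ultimately show ?thesis by auto
qed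

lemma rho_A_deriv:
  obtains R' where "(RA has_vector_derivative R') (at t)"
    "R' $ 1 $ 1 = (\<Sum>n. transfer_rate n t)" "R' $ 0 $ 0 = - (\<Sum>n. transfer_rate n t)"
proof -
  obtain d where d: "((\<lambda>s. RA s $ 1 $ 0) has_vector_derivative d) (at t)"
    using rho_A_coherence_deriv by blast
  have d': "((\<lambda>s. RA s $ 0 $ 1) has_vector_derivative cnj d) (at t)"
  proof -
    have "RA s $ 0 $ 1 = cnj (RA s $ 1 $ 0)" for s
      using hermitian_entries(1)[OF cadj_rho_A] by simp
    then show ?thesis
      using bounded_linear.has_vector_derivative[OF bounded_linear_cnj d] by simp
  qed
  have low: "((\<lambda>s. RA s $ 0 $ 0) has_vector_derivative - (\<Sum>n. transfer_rate n t)) (at t)"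
  proof -
    have "RA s $ 0 $ 0 = 1 - RA s $ 1 $ 1" for s
      using trace_rho_A[of s] by (simp add: trace_2_01 algebra_simps)
    moreover have "((\<lambda>s. 1 - RA s $ 1 $ 1) has_vector_derivative 0 - (\<Sum>n. transfer_rate n t)) (at t)"
      by (intro has_vector_derivative_diff has_vector_derivative_const rho_A_upper_deriv)
    ultimately show ?thesis by simp
  qed
  define R' :: "complex^2^2" where
    "R' = (\<chi> i j. if i = 0 then (if j = 0 then - (\<Sum>n. transfer_rate n t) else cnj d) else (if j = 0 then d else (\<Sum>n. transfer_rate n t)))"
  have "((\<lambda>s. RA s $ i $ j) has_vector_derivative R' $ i $ j) (at t)" for i j
    by (cases i rule: two_cases; cases j rule: two_cases)
      (simp_all add: R'_def low d d' rho_A_upper_deriv)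
  then have "(RA has_vector_derivative R') (at t)" by (rule has_vector_derivative_matrixI)
  then show ?thesis by (rule that) (simp_all add: R'_def)
qed

section \<open>The instantaneous fixed point\<close>

lemma summable_w_c: "summable (\<lambda>n. w n * c (n + k) s)"
  by (rule summable_comparison_test'[OF summable_w, of 0])
    (simp add: abs_mult w_nonneg c_coeff_nonneg c_coeff_le_1 mult_left_le)

lemma alpha_eq_beta: "alpha \<omega>A \<omega>B \<beta>B g s = 1 - q + q * beta \<omega>A \<omega>B \<beta>B g s"
proof -
  have "alpha \<omega>A \<omega>B \<beta>B g s = (\<Sum>n. w n * c n s)"
    by (simp add: alpha_def thermal_weight_def)
  also have "\<dots> = w 0 * c 0 s + (\<Sum>n. w (Suc n) * c (Suc n) s)"
    using suminf_split_head[OF summable_w_c[of 0]] by simp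
  also have "(\<Sum>n. w (Suc n) * c (Suc n) s) = q * (\<Sum>n. w n * c (n + 1) s)"
    using suminf_mult[OF summable_w_c[of 1], of q] by (simp add: thermal_weight_Suc mult.assoc)
  also have "(\<Sum>n. w n * c (n + 1) s) = beta \<omega>A \<omega>B \<beta>B g s"
    by (simp add: beta_def thermal_weight_def)
  finally show ?thesis by (simp add: c_coeff_0 thermal_weight_geometric)
qed

text \<open>Only \<beta> is differentiated as a series; the derivative of \<alpha> follows from the
  affine relation \<open>alpha_eq_beta\<close>.\<close>

lemma beta_deriv: "\<exists>b. (beta \<omega>A \<omega>B \<beta>B g has_real_derivative b) (at t)"
proof -
  have d: "((\<lambda>s. w n * c (n + 1) s) has_vector_derivative w n * c_deriv \<omega>A \<omega>B g (n + 1) s) (at s)" for n s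
    using c_coeff_deriv[of \<omega>A \<omega>B g "n + 1" s]
    unfolding has_real_derivative_iff_has_vector_derivative by (rule has_vector_derivative_mult_right)
  have b: "norm (w n * c_deriv \<omega>A \<omega>B g (n + 1) s)
      \<le> (\<bar>\<omega>A - \<omega>B\<bar> + 2 * \<bar>g\<bar>) * ((real n + 2) * w n)" for n s
  proof -
    have "norm (w n * c_deriv \<omega>A \<omega>B g (n + 1) s)
      \<le> w n * ((\<bar>\<omega>A - \<omega>B\<bar> + 2 * \<bar>g\<bar>) * (real (n + 1) + 1))"
      unfolding real_norm_def abs_mult by (intro mult_mono c_deriv_le) (auto simp: w_nonneg)
    then show ?thesis by (simp add: mult_ac add_ac)
  qed
  have "((\<lambda>s. \<Sum>n. w n * c (n + 1) s) has_vector_derivative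
      (\<Sum>n. w n * c_deriv \<omega>A \<omega>B g (n + 1) t)) (at t)"
    by (rule has_vector_derivative_suminf[OF d b summable_mult[OF summable_w1] summable_w_c])
  moreover have "beta \<omega>A \<omega>B \<beta>B g = (\<lambda>s. \<Sum>n. w n * c (n + 1) s)"
    by (simp add: fun_eq_iff beta_def thermal_weight_def)
  ultimately show ?thesis
    by (auto simp: has_real_derivative_iff_has_vector_derivative)
qed

lemma rho_fp_diag:
  assumes ab: "alpha \<omega>A \<omega>B \<beta>B g t + beta \<omega>A \<omega>B \<beta>B g t \<noteq> 1"
    and gg: "gamma1 \<omega>A \<omega>B \<beta>B g t + gamma2 \<omega>A \<omega>B \<beta>B g t \<noteq> 0"
  shows "rho_fp \<omega>A \<omega>B \<beta>B g t $ 0 $ 0 = of_real (1 / (1 + q))"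
    "rho_fp \<omega>A \<omega>B \<beta>B g t $ 1 $ 1 = of_real (q / (1 + q))"
proof -
  let ?\<alpha> = "alpha \<omega>A \<omega>B \<beta>B g" and ?\<beta> = "beta \<omega>A \<omega>B \<beta>B g"
  obtain b where b: "(?\<beta> has_real_derivative b) (at t)" using beta_deriv by blast
  have "(?\<alpha> has_real_derivative 0 + q * b) (at t)"
    unfolding alpha_eq_beta[abs_def] by (intro DERIV_add DERIV_const DERIV_cmult b)
  then have d: "deriv ?\<alpha> t = q * b" "deriv ?\<beta> t = b"
    using b by (auto intro: DERIV_imp_deriv)
  \<comment> \<open>The value of \<gamma>2: inserting \<alpha> = 1 - q + q \<beta> reduces the
    numerators of \<gamma>2 and \<gamma>1 to - b and - q b.\<close>
  define m where "m = - b / (?\<alpha> t + ?\<beta> t - 1)"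
  have g2: "gamma2 \<omega>A \<omega>B \<beta>B g t = m"
    unfolding gamma2_def Let_def d m_def by (simp add: alpha_eq_beta algebra_simps)
  have "?\<alpha> t * b - q * b * ?\<beta> t - b = q * (- b)" by (simp add: alpha_eq_beta algebra_simps)
  then have g1: "gamma1 \<omega>A \<omega>B \<beta>B g t = q * m"
    unfolding gamma1_def Let_def d m_def by simp
  have m: "m \<noteq> 0" using gg unfolding g1 g2 by auto
  have q0: "1 + q > 0" by (simp add: add_pos_pos)
  have eq: "complex_of_real (q * m) + of_real m = of_real ((1 + q) * m)"
    by (simp add: algebra_simps)
  show "rho_fp \<omega>A \<omega>B \<beta>B g t $ 0 $ 0 = of_real (1 / (1 + q))"
    "rho_fp \<omega>A \<omega>B \<beta>B g t $ 1 $ 1 = of_real (q / (1 + q))"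
    unfolding rho_fp_entries g1 g2 eq of_real_divide[symmetric] using m q0 by simp_all
qed

end

theorem mainTheorem2:
  fixes \<omega>A \<omega>B \<beta>B g t :: real and \<rho>0 :: "complex^2^2"
  assumes "\<omega>A > 0" and "\<omega>B > 0" and "\<beta>B > 0"
    and "density_matrix \<rho>0"
    and "alpha \<omega>A \<omega>B \<beta>B g t + beta \<omega>A \<omega>B \<beta>B g t \<noteq> 1"
    and "gamma1 \<omega>A \<omega>B \<beta>B g t + gamma2 \<omega>A \<omega>B \<beta>B g t \<noteq> 0"
    and "invertible (rho_A \<omega>A \<omega>B \<beta>B g \<rho>0 t)"
  shows "sigma_Es \<omega>A \<omega>B \<beta>B g \<rho>0 t = sigma_fp \<omega>A \<omega>B \<beta>B g \<rho>0 t"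
proof -
  let ?q = "exp (- \<beta>B * \<omega>B)" and ?R = "rho_A \<omega>A \<omega>B \<beta>B g \<rho>0"
  note pos = assms(2,3) and dens = assms(4)
  obtain R' d where R': "(?R has_vector_derivative R') (at t)"
    and d: "R' $ 1 $ 1 = d" "R' $ 0 $ 0 = - d" "dE_B \<omega>A \<omega>B \<beta>B g \<rho>0 t = - of_real \<omega>B * d"
    using rho_A_deriv[OF pos dens, of \<omega>A g t] dE_B_eq[OF pos dens, of \<omega>A g t] by metis
  have "(S_A \<omega>A \<omega>B \<beta>B g \<rho>0 has_vector_derivative - trace (R' ** mat_ln (?R t))) (at t)"
    unfolding S_A_def[abs_def]
    by (rule has_vector_derivative_entropy[OF cadj_rho_A[OF pos dens] trace_rho_A[OF pos dens] R' assms(7)])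
  then have Es: "sigma_Es \<omega>A \<omega>B \<beta>B g \<rho>0 t = - trace (R' ** mat_ln (?R t)) - \<beta>B * \<omega>B * d"
    by (simp add: sigma_Es_def vector_derivative_at d)
  note fp = rho_fp_diag[OF pos dens assms(5,6)] rho_fp_entries(4,3)[of \<omega>A \<omega>B \<beta>B g t]
  \<comment> \<open>The populations change by d and - d and the logarithm of the fixed point is
    diagonal, so only the difference of its two diagonal entries enters.\<close>
  have "trace (R' ** mat_ln (rho_fp \<omega>A \<omega>B \<beta>B g t)) = d * of_real (ln (?q / (1 + ?q)) - ln (1 / (1 + ?q)))"
    unfolding mat_ln_def trace_2_01 mult_2_01 herm_fun_diagonal[OF fp] d
    by (simp add: algebra_simps)
  also have "ln (?q / (1 + ?q)) - ln (1 / (1 + ?q)) = - \<beta>B * \<omega>B"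
    using add_pos_pos[OF zero_less_one exp_gt_zero[of "- \<beta>B * \<omega>B"], THEN less_imp_neq]
    by (simp add: ln_div)
  finally have "trace (R' ** mat_ln (rho_fp \<omega>A \<omega>B \<beta>B g t)) = - \<beta>B * \<omega>B * d"
    by (simp add: mult_ac)
  moreover have "sigma_fp \<omega>A \<omega>B \<beta>B g \<rho>0 t
     = - trace (R' ** mat_ln (?R t)) + trace (R' ** mat_ln (rho_fp \<omega>A \<omega>B \<beta>B g t))"
    unfolding sigma_fp_def vector_derivative_at[OF R']
    by (simp add: trace_2_01 mult_2_01 algebra_simps)
  ultimately show ?thesis by (simp add: Es)
qed

end
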